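(* Let $\mathbf v$ be a complementary symmetric Rote sequence and let $\mathbf u$ be the standard Sturmian sequence such that $\mathcal L(\mathcal S(\mathbf v))=\mathcal L(\mathbf u)$. If $\mathbf u$ has the directive sequence $G^{a_1}D^{a_2}G^{a_3}D^{a_4}\cdots$, then for every $N\in\mathbb N$ and every integer $n\in[q'_N,q'_{N+1})$ the value $R_{\mathbf v}(n+1)$ of the recurrence function is: - if $q_N$ is even: $R_{\mathbf v}(n+1)=2q'_{N+1}+q'_N+n$ when $a_{N+2}>1$, and $R_{\mathbf v}(n+1)=2q'_{N+2}+n$ when $a_{N+2}=1$; - if $q_{N+1}$ is even: $R_{\mathbf v}(n+1)=q'_{N+2}+2q'_{N+1}+q'_N+n$ when $a_{N+2}>1$, and $R_{\mathbf v}(n+1)=2q'_{N+2}+q'_{N+1}+n$ when $a_{N+2}=1$; - if $q_N$ and $q_{N+1}$ are both odd: $R_{\mathbf v}(n+1)=3q'_{N+1}+q'_N+n$ when $a_{N+2}>1$, and $R_{\mathbf v}(n+1)=q'_{N+3}+q'_{N+2}+q'_{N+1}+n$ when $a_{N+2}=1$. If $\mathbf u$ has the directive sequence $D^{a_1}G^{a_2}D^{a_3}G^{a_4}\cdots$, then for every $N\in\mathbb N$ and every integer $n\in[q'_N,q'_{N+1})$ the value $R_{\mathbf v}(n+1)$ is: - if $p_N$ is even: $R_{\mathbf v}(n+1)=2q'_{N+1}+q'_N+n$ when $a_{N+2}>1$, and $R_{\mathbf v}(n+1)=2q'_{N+2}+n$ when $a_{N+2}=1$; - if $p_{N+1}$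 is even: $R_{\mathbf v}(n+1)=q'_{N+2}+2q'_{N+1}+q'_N+n$ when $a_{N+2}>1$, and $R_{\mathbf v}(n+1)=2q'_{N+2}+q'_{N+1}+n$ when $a_{N+2}=1$; - if $p_N$ and $p_{N+1}$ are both odd: $R_{\mathbf v}(n+1)=3q'_{N+1}+q'_N+n$ when $a_{N+2}>1$, and $R_{\mathbf v}(n+1)=q'_{N+3}+q'_{N+2}+q'_{N+1}+n$ when $a_{N+2}=1$.
   Context: $\mathbb N=\{0,1,2,\dots\}$. Sequences are right-infinite words; $\mathcal L(\mathbf u)$ is the set of finite factors of $\mathbf u$. For a uniformly recurrent sequence $\mathbf v$ (every factor occurs infinitely often with bounded gaps), the recurrence function is $R_{\mathbf v}(n)=\min\{N\in\mathbb N:\text{each factor of }\mathbf v\text{ of length }N\text{ contains all factors of }\mathbf v\text{ of length }n\}$. A Rote sequence is a binary sequence having exactly $2n$ factors of length $n$ for every $n\ge1$. It is complementary symmetric (CS) if its language is closed under the exchange of letters $0\leftrightarrow1$; CS Rote sequences are uniformly recurrent. For a binary sequence $\mathbf v=v_0v_1\cdots$, $\mathcal S(\mathbf v)=u_0u_1\cdots$ with $u_i=v_i+v_{i+1}\bmod2$. A Sturmian sequence (over $\{0,1\}$) has exactly $n+1$ factors of length $n$ for every $n\in\mathbb N$; it is standard if both $0\mathbf u$ and $1\mathbf u$ are Sturmian. Known facts: $\mathbf v$ is CS Rote iff $\mathcal S(\mathbf v)$ is Sturmian; each Sturmian sequence has the same language as exactly one standard Sturmian sequence. Directive sequence: let $G:0\mapsto10,\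 1\mapsto1$ and $D:0\mapsto0,\ 1\mapsto01$. For every standard Sturmian $\mathbf u$ there is a unique sequence $\Delta_0\Delta_1\Delta_2\cdots\in\{G,D\}^{\mathbb N}$ (the directive sequence of $\mathbf u$) for which there are standard Sturmian sequences $\mathbf u^{(n)}$ with $\mathbf u=\Delta_0\Delta_1\cdots\Delta_{n-1}(\mathbf u^{(n)})$ for all $n\in\mathbb N$. It contains infinitely many $G$ and infinitely many $D$, so it is $G^{a_1}D^{a_2}G^{a_3}D^{a_4}\cdots$ or $D^{a_1}G^{a_2}D^{a_3}G^{a_4}\cdots$ with positive integers $a_i$. The integers $p_N,q_N,q'_N$ (related to the convergents of $\theta=[0,a_1,a_2,\dots]$ and $\theta/(1+\theta)$) all satisfy $X_N=a_NX_{N-1}+X_{N-2}$ for $N\ge1$, with $p_{-1}=1,p_0=0$; $q_{-1}=0,q_0=1$; $q'_{-1}=q'_0=1$. Thus $q'_N=p_N+q_N$. At most one of $q_N,q_{N+1}$ is even, and at most one of $p_N,p_{N+1}$ is even. *)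

theory Defs
  imports "HOL-Library.Stream" "HOL-Library.Z2" "HOL-Library.Sublist"
begin

(* Binary sequences are streams over the two-element field bit = {0, 1}: addition
   of letters is addition modulo 2, and x \<mapsto> x + 1 exchanges the letters. *)

definition factors :: "'a stream \<Rightarrow> nat \<Rightarrow> 'a list set" where
  "factors s n = {stake n (sdrop i s) | i. True}"

definition language :: "'a stream \<Rightarrow> 'a list set" where
  "language s = (\<Union>n. factors s n)"

(* For uniformly recurrent s the set of such N is nonempty, so LEAST is the minimum;
   otherwise the value may be unspecified. *)
definition recurrence_function :: "'a stream \<Rightarrow> nat \<Rightarrow> nat" where
  "recurrence_function s n =
     (LEAST N. \<forall>w \<in> factors s N. \<forall>x \<in> factors s n. sublist x w)"

definition rote :: "bit stream \<Rightarrow> bool" where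
  "rote v \<longleftrightarrow> (\<forall>n\<ge>1. card (factors v n) = 2 * n)"

definition complementary_symmetric :: "bit stream \<Rightarrow> bool" where
  "complementary_symmetric v \<longleftrightarrow> (\<forall>w \<in> language v. map (\<lambda>x. x + 1) w \<in> language v)"

definition CS_rote :: "bit stream \<Rightarrow> bool" where
  "CS_rote v \<longleftrightarrow> rote v \<and> complementary_symmetric v"

definition sum_stream :: "bit stream \<Rightarrow> bit stream" where
  "sum_stream v = smap2 (+) v (stl v)"

definition sturmian :: "bit stream \<Rightarrow> bool" where
  "sturmian u \<longleftrightarrow> (\<forall>n. card (factors u n) = n + 1)"

definition standard_sturmian :: "bit stream \<Rightarrow> bool" where
  "standard_sturmian u \<longleftrightarrow> sturmian u \<and> sturmian (0 ## u) \<and> sturmian (1 ## u)"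

datatype sturmian_morphism = G | D

fun letter_image :: "sturmian_morphism \<Rightarrow> bit \<Rightarrow> bit list" where
  "letter_image G x = (if x = 0 then [1, 0] else [1])"
| "letter_image D x = (if x = 0 then [0] else [0, 1])"

definition apply_morphism :: "sturmian_morphism \<Rightarrow> bit stream \<Rightarrow> bit stream" where
  "apply_morphism f u = flat (smap (letter_image f) u)"

(* foldr composes so that the first element of \<Delta> is the outermost morphism. *)
definition directive_sequence :: "bit stream \<Rightarrow> sturmian_morphism stream \<Rightarrow> bool" where
  "directive_sequence u \<Delta> \<longleftrightarrow>
     (\<exists>U. \<forall>n. standard_sturmian (U n) \<and> u = foldr apply_morphism (stake n \<Delta>) (U n))"

(* The sequence X^(a 1) Y^(a 2) X^(a 3) Y^(a 4) ..., meaningful only when a i > 0 for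
   all i \<ge> 1, since flat needs nonempty blocks; a 0 is not used. *)
definition alternating_powers :: "'a \<Rightarrow> 'a \<Rightarrow> (nat \<Rightarrow> nat) \<Rightarrow> 'a stream" where
  "alternating_powers X Y a =
     flat (smap (\<lambda>i. replicate (a i) (if odd i then X else Y)) (fromN 1))"

(* convergent_rec a x y N is X_N, where X_{-1} = x, X_0 = y and
   X_N = a_N * X_{N-1} + X_{N-2} for N \<ge> 1. *)
fun convergent_rec :: "(nat \<Rightarrow> nat) \<Rightarrow> nat \<Rightarrow> nat \<Rightarrow> nat \<Rightarrow> nat" where
  "convergent_rec a x y 0 = y"
| "convergent_rec a x y (Suc 0) = a 1 * y + x"
| "convergent_rec a x y (Suc (Suc N)) =
     a (Suc (Suc N)) * convergent_rec a x y (Suc N) + convergent_rec a x y N"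

definition conv_p :: "(nat \<Rightarrow> nat) \<Rightarrow> nat \<Rightarrow> nat" where
  "conv_p a = convergent_rec a 1 0"

definition conv_q :: "(nat \<Rightarrow> nat) \<Rightarrow> nat \<Rightarrow> nat" where
  "conv_q a = convergent_rec a 0 1"

definition conv_q' :: "(nat \<Rightarrow> nat) \<Rightarrow> nat \<Rightarrow> nat" where
  "conv_q' a = convergent_rec a 1 1"

end

theory Submission
  imports Defs Complex_Main
begin

text \<open>The factors of \<open>v\<close> are those of the codings \<open>i \<mapsto> \<lfloor>z + i \<alpha>\<rfloor> mod 2\<close> of the rotation by \<open>\<alpha>\<close> on the
  circle \<open>\<real>/2\<int>\<close>, where \<open>\<alpha>\<close> is the frequency of the letter 1 in \<open>u\<close>. The factors of length
  \<open>n + 1\<close> correspond to the arcs into which the points \<open>-j\<alpha>\<close> and \<open>1 - j\<alpha>\<close>, \<open>j \<le> n\<close>, cut this circle,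
  and a window sees all factors as soon as it sees the one with the shortest arc. For
  \<open>q'\<^sub>N \<le> n < q'\<^sub>N\<^sub>+\<^sub>1\<close> that arc has length \<open>l = \<bar>q'\<^sub>N \<alpha> - p\<bar>\<close>, with \<open>p / q'\<^sub>N\<close> the convergent of \<open>\<alpha>\<close>,
  so \<open>R\<^sub>v(n + 1) = T + n\<close> with \<open>T\<close> least such that every half-open arc of length \<open>l\<close> of \<open>\<real>/2\<int>\<close>
  contains some \<open>k\<alpha>\<close>, \<open>k < T\<close>. As in the three gap theorem, \<open>T\<close> is the sum of the first times of
  return to within \<open>l\<close> of 0 from either side, or their maximum if the two distances add up to
  \<open>l\<close>. Writing times in the basis of two consecutive convergents finds these times; the
  parities of the numerators enter because only even integers vanish in \<open>\<real>/2\<int>\<close>.\<close>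

section \<open>Orbits of a rotation on the circle of length two\<close>

definition orbit_covers :: "real \<Rightarrow> real \<Rightarrow> nat \<Rightarrow> bool" where
  "orbit_covers \<alpha> l T \<longleftrightarrow>
     (\<forall>y. \<exists>k<T. \<exists>e::int. y \<le> real k * \<alpha> + 2 * of_int e \<and> real k * \<alpha> + 2 * of_int e < y + l)"

text \<open>The first orbit point at or after \<open>y\<close> has an orbit point at most
  \<open>l\<close> behind it. By minimality that one lies before \<open>y\<close>, so the first
  point lies before \<open>y + l\<close>.\<close>

lemma orbit_covers_predecessor:
  assumes T: "0 < T"
    and pred: "\<And>k. k < T \<Longrightarrow>
      \<exists>k'<T. \<exists>e::int. 0 < (real k - real k') * \<alpha> - 2 * of_int e \<and> (real k - real k') * \<alpha> - 2 * of_int e \<le> l"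
  shows "orbit_covers \<alpha> l T"
  unfolding orbit_covers_def
proof
  fix y :: real
  \<comment> \<open>\<open>g k\<close> is the smallest number congruent to
    \<open>real k * \<alpha>\<close> modulo 2 that is at least \<open>y\<close>.\<close>
  define g where "g k = real k * \<alpha> + 2 * of_int \<lceil>(y - real k * \<alpha>) / 2\<rceil>" for k :: nat
  have least: "g k \<le> real k * \<alpha> + 2 * of_int e" if "y \<le> real k * \<alpha> + 2 * of_int e" for k and e :: int
  proof -
    have "(y - real k * \<alpha>) / 2 \<le> of_int e" using that by simp
    then have "\<lceil>(y - real k * \<alpha>) / 2\<rceil> \<le> e" by (simp add: ceiling_le_iff)
    then show ?thesis by (simp add: g_def)
  qed
  have ge: "y \<le> g k" for k
  proof -
    define c :: real where "c = of_int \<lceil>(y - real k * \<alpha>) / 2\<rceil>"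
    have "(y - real k * \<alpha>) / 2 \<le> c" unfolding c_def by (rule le_of_int_ceiling)
    then show ?thesis unfolding g_def c_def[symmetric] by (simp add: field_simps)
  qed
  have fin: "finite (g ` {..<T})" "g ` {..<T} \<noteq> {}" using T by auto
  from Min_in[OF fin] obtain k where k: "k < T" "g k = Min (g ` {..<T})" by auto
  have min: "g k \<le> g k'" if "k' < T" for k' using k(2) fin that by auto
  from pred[OF k(1)] obtain k' and e :: int where k': "k' < T"
      and e: "0 < (real k - real k') * \<alpha> - 2 * of_int e" "(real k - real k') * \<alpha> - 2 * of_int e \<le> l"
    by blast
  define c where "c = \<lceil>(y - real k * \<alpha>) / 2\<rceil> + e"
  have eq: "real k' * \<alpha> + 2 * of_int c = g k - ((real k - real k') * \<alpha> - 2 * of_int e)"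
    by (simp add: c_def g_def algebra_simps)
  have "real k' * \<alpha> + 2 * of_int c < y"
  proof (rule ccontr)
    assume "\<not> ?thesis"
    then have "g k' \<le> real k' * \<alpha> + 2 * of_int c" by (intro least) simp
    then show False using eq e(1) min[OF k'] by linarith
  qed
  then have "g k < y + l" using eq e(2) by linarith
  then show "\<exists>k<T. \<exists>e::int. y \<le> real k * \<alpha> + 2 * of_int e \<and> real k * \<alpha> + 2 * of_int e < y + l"
    using k(1) ge[of k] unfolding g_def by blast
qed

text \<open>\<open>R\<close> steps move a point forward and \<open>L\<close> steps move it backward.
  A point behind that of index \<open>k\<close> has index \<open>k - R\<close> or
  \<open>k + L\<close>. If both leave the range then \<open>R + L > T\<close>, and the index
  \<open>k + L - R\<close> goes back by the sum of the two distances.\<close>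

lemma orbit_coversI:
  fixes r m :: int
  assumes "0 < T" "R \<le> T" "L \<le> T"
    and R: "0 < real R * \<alpha> - 2 * of_int r" "real R * \<alpha> - 2 * of_int r \<le> l"
    and L: "0 < 2 * of_int m - real L * \<alpha>" "2 * of_int m - real L * \<alpha> \<le> l"
    and sum: "R + L \<le> T \<or> (real R * \<alpha> - 2 * of_int r) + (2 * of_int m - real L * \<alpha>) \<le> l"
  shows "orbit_covers \<alpha> l T"
proof (rule orbit_covers_predecessor[OF \<open>0 < T\<close>])
  fix k assume k: "k < T"
  consider "R \<le> k" | "k < R" "k + L < T" | "k < R" "T \<le> k + L" by linarith
  then show "\<exists>k'<T. \<exists>e::int. 0 < (real k - real k') * \<alpha> - 2 * of_int e \<and>
      (real k - real k') * \<alpha> - 2 * of_int e \<le> l"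
  proof cases
    case 1
    have "real k - real (k - R) = real R" using 1 by simp
    then show ?thesis using R k by (intro exI[of _ "k - R"] conjI exI[of _ r]) auto
  next
    case 2
    then show ?thesis using L by (intro exI[of _ "k + L"] conjI exI[of _ "- m"]) auto
  next
    case 3
    have eq: "real k - real (k + L - R) = real R - real L"
      using 3 assms by (simp add: of_nat_diff)
    have disp: "(real k - real (k + L - R)) * \<alpha> - 2 * of_int (r - m)
        = (real R * \<alpha> - 2 * of_int r) + (2 * of_int m - real L * \<alpha>)"
      unfolding eq by (simp add: algebra_simps)
    have "k + L - R < T" using 3 assms by linarith
    moreover have "0 < (real k - real (k + L - R)) * \<alpha> - 2 * of_int (r - m)"
      "(real k - real (k + L - R)) * \<alpha> - 2 * of_int (r - m) \<le> l"
      unfolding disp using R(1) L(1) sum 3 by linarith+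
    ultimately show ?thesis by blast
  qed
qed

text \<open>The arc of length \<open>l\<close> ending just before the point of index
  \<open>k0\<close> is missed: a hit at step \<open>k\<close> would be a displacement in
  \<open>(0, l]\<close> in time \<open>k0 - k\<close>, or \<open>k - k0\<close> if
  \<open>s = -1\<close>. With the chosen \<open>k0\<close> these times fill the window from
  \<open>c\<close>, which may contain negative times and so can lie between a backward and a forward
  return.\<close>

lemma not_orbit_coversI:
  fixes c :: int and s :: real
  assumes s: "s = 1 \<or> s = -1"
    and avoid: "\<And>j e :: int. c \<le> j \<Longrightarrow> j < c + int T \<Longrightarrow>
      0 < s * (of_int j * \<alpha> - 2 * of_int e) \<Longrightarrow> s * (of_int j * \<alpha> - 2 * of_int e) \<le> l \<Longrightarrow> False"
  shows "\<not> orbit_covers \<alpha> l T"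
proof
  assume cov: "orbit_covers \<alpha> l T"
  define k0 where "k0 = (if s = 1 then c + int T - 1 else - c)"
  obtain k and e :: int where k: "k < T"
    and e: "of_int k0 * \<alpha> - l \<le> real k * \<alpha> + 2 * of_int e"
      "real k * \<alpha> + 2 * of_int e < of_int k0 * \<alpha> - l + l"
    using cov unfolding orbit_covers_def by blast
  show False
  proof (cases "s = 1")
    case True
    show False
      by (rule avoid[of "k0 - int k" e]) (use True k e in \<open>auto simp: k0_def algebra_simps\<close>)
  next
    case False
    then have "s = -1" using s by simp
    show False
      by (rule avoid[of "int k - k0" "- e"])
        (use \<open>s = -1\<close> k e in \<open>auto simp: k0_def algebra_simps\<close>)
  qed
qed

lemma orbit_covers_mono: "orbit_covers \<alpha> l T \<Longrightarrow> l \<le> l' \<Longrightarrow> orbit_covers \<alpha> l' T"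
  unfolding orbit_covers_def by (meson add_left_mono order_less_le_trans)

section \<open>Times and displacements in the basis of two consecutive convergents\<close>

text \<open>In the following locale \<open>x * Q + y * Q1\<close> rotation steps move a point of \<open>\<real>\<close> by
  \<open>x * \<eta> - y * \<eta>1\<close>, up to the sign \<open>s\<close> and the integer \<open>x * P + y * P1\<close>; only the steps
  for which this integer is even return to the same place of \<open>\<real>/2\<int>\<close>.\<close>

locale convergent_pair =
  fixes \<alpha> :: real and Q Q1 P P1 :: nat and \<eta> \<eta>1 s :: real
  assumes sign: "s = 1 \<or> s = -1"
    and dist: "s * (real Q * \<alpha> - real P) = \<eta>" "s * (real Q1 * \<alpha> - real P1) = - \<eta>1"
    and \<eta>: "0 < \<eta>1" "\<eta>1 < \<eta>"
    and Q_pos: "0 < Q" "0 < Q1"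
    and det: "int P1 * int Q - int P * int Q1 = 1 \<or> int P1 * int Q - int P * int Q1 = -1"
begin

text \<open>The change of basis has determinant \<open>t\<close>, equal to 1 or -1, so Cramer's rule
  gives integer coordinates and dividing by \<open>t\<close> is multiplying by it.\<close>

lemma lattice_coordinates:
  fixes j m :: int
  obtains x y :: int where "j = x * int Q + y * int Q1" "m = x * int P + y * int P1"
    "s * (of_int j * \<alpha> - of_int m) = of_int x * \<eta> - of_int y * \<eta>1"
proof -
  obtain t :: int where t: "t * t = 1" "int P1 * int Q - int P * int Q1 = t" using det by fastforce
  define x where "x = t * (int P1 * j - int Q1 * m)"
  define y where "y = t * (int Q * m - int P * j)"
  have "x * int Q + y * int Q1 = t * (int P1 * int Q - int P * int Q1) * j"
    by (simp add: x_def y_def algebra_simps)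
  then have j: "j = x * int Q + y * int Q1" using t by simp
  have "x * int P + y * int P1 = t * (int P1 * int Q - int P * int Q1) * m"
    by (simp add: x_def y_def algebra_simps)
  then have m: "m = x * int P + y * int P1" using t by simp
  have "s * (of_int j * \<alpha> - of_int m)
      = of_int x * (s * (real Q * \<alpha> - real P)) + of_int y * (s * (real Q1 * \<alpha> - real P1))"
    unfolding j m by (simp add: algebra_simps)
  then show ?thesis using that[OF j m] dist by simp
qed

text \<open>\<open>x = 0\<close> would make \<open>j\<close> a multiple of \<open>Q1\<close>, and
  coordinates of the same strict sign would give \<open>\<bar>j\<bar> \<ge> Q1\<close>. So
  \<open>x\<close> is nonzero and \<open>y\<close> is zero or of opposite sign; the two
  contributions to the displacement then reinforce each other.\<close>

lemma best_approximation:
  fixes j m :: int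
  assumes "j \<noteq> 0" "\<bar>j\<bar> < int Q1"
  shows "\<eta> \<le> \<bar>of_int j * \<alpha> - of_int m\<bar>"
proof -
  obtain x y :: int where xy: "j = x * int Q + y * int Q1"
    "s * (of_int j * \<alpha> - of_int m) = of_int x * \<eta> - of_int y * \<eta>1"
    using lattice_coordinates by metis
  have abs: "\<bar>of_int j * \<alpha> - of_int m\<bar> = \<bar>of_int x * \<eta> - of_int y * \<eta>1\<bar>"
    unfolding xy(2)[symmetric] using sign by auto
  have x: "x \<noteq> 0"
  proof
    assume "x = 0"
    then have "\<bar>j\<bar> = \<bar>y\<bar> * int Q1" "y \<noteq> 0" using xy assms by (auto simp: abs_mult)
    moreover have "1 * int Q1 \<le> \<bar>y\<bar> * int Q1" using \<open>y \<noteq> 0\<close> by (intro mult_right_mono) auto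
    ultimately show False using assms by linarith
  qed
  have "of_int x * of_int y \<le> (0::real)"
  proof (rule ccontr)
    assume "\<not> ?thesis"
    then have "0 < x * y" by (simp flip: of_int_mult)
    then consider "1 \<le> x" "1 \<le> y" | "x \<le> -1" "y \<le> -1" by (auto simp: zero_less_mult_iff)
    then show False
    proof cases
      case 1
      then have "0 \<le> x * int Q" "1 * int Q1 \<le> y * int Q1"
        using mult_right_mono[of 1 y "int Q1"] by auto
      then show False using assms xy(1) by linarith
    next
      case 2
      then have "x * int Q \<le> 0" "y * int Q1 \<le> (-1) * int Q1"
        using mult_right_mono[of y "-1" "int Q1"] by (auto intro: mult_nonpos_nonneg)
      then show False using assms xy(1) by linarith
    qed
  qed
  then have opp: "(of_int x \<ge> (1::real) \<and> of_int y \<le> (0::real)) \<or> (of_int x \<le> (-1::real) \<and> of_int y \<ge> (0::real))"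
    using x by (auto simp: mult_le_0_iff simp flip: of_int_mult)
  then show ?thesis unfolding abs
  proof
    assume a: "of_int x \<ge> (1::real) \<and> of_int y \<le> (0::real)"
    have "1 * \<eta> \<le> of_int x * \<eta>" "of_int y * \<eta>1 \<le> 0"
      using a \<eta> by (auto intro: mult_right_mono mult_nonpos_nonneg)
    then show "\<eta> \<le> \<bar>of_int x * \<eta> - of_int y * \<eta>1\<bar>" by linarith
  next
    assume a: "of_int x \<le> (-1::real) \<and> of_int y \<ge> (0::real)"
    have "of_int x * \<eta> \<le> (-1) * \<eta>" using a \<eta> by (intro mult_right_mono) auto
    moreover have "0 \<le> of_int y * \<eta>1" using a \<eta> by simp
    ultimately show "\<eta> \<le> \<bar>of_int x * \<eta> - of_int y * \<eta>1\<bar>" by linarith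
  qed
qed

text \<open>Even numerators are whole turns of \<open>\<real>/2\<int>\<close>. The pair
  \<open>(x, y)\<close> describes the move in the direction \<open>s\<close> and
  \<open>(x', y')\<close> the opposite one, so for \<open>s = -1\<close> they exchange the roles of
  \<open>R\<close> and \<open>L\<close> in \<open>orbit_coversI\<close>.\<close>

lemma orbit_coversI_lattice:
  fixes x y x' y' T :: nat
  assumes T: "0 < T" "x * Q + y * Q1 \<le> T" "x' * Q + y' * Q1 \<le> T"
    and par: "even (x * P + y * P1)" "even (x' * P + y' * P1)"
    and R: "0 < real x * \<eta> - real y * \<eta>1" "real x * \<eta> - real y * \<eta>1 \<le> l"
    and L: "0 < real y' * \<eta>1 - real x' * \<eta>" "real y' * \<eta>1 - real x' * \<eta> \<le> l"
    and sum: "(x * Q + y * Q1) + (x' * Q + y' * Q1) \<le> T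
      \<or> (real x * \<eta> - real y * \<eta>1) + (real y' * \<eta>1 - real x' * \<eta>) \<le> l"
  shows "orbit_covers \<alpha> l T"
proof -
  obtain r where r: "x * P + y * P1 = 2 * r" using par(1) by blast
  obtain m where m: "x' * P + y' * P1 = 2 * m" using par(2) by blast
  have gen: "s * (real (x * Q + y * Q1) * \<alpha> - real (x * P + y * P1)) = real x * \<eta> - real y * \<eta>1" for x y
  proof -
    have "s * (real (x * Q + y * Q1) * \<alpha> - real (x * P + y * P1))
      = real x * (s * (real Q * \<alpha> - real P)) + real y * (s * (real Q1 * \<alpha> - real P1))"
      by (simp add: algebra_simps)
    then show ?thesis using dist by simp
  qed
  note g = gen[of x y, unfolded r] gen[of x' y', unfolded m]
  define A B where "A = x * Q + y * Q1" and "B = x' * Q + y' * Q1"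
  define u w where "u = real x * \<eta> - real y * \<eta>1" and "w = real x' * \<eta> - real y' * \<eta>1"
  note folds = A_def[symmetric] B_def[symmetric] u_def[symmetric] w_def[symmetric]
  have R': "0 < u" "u \<le> l" using R by (auto simp: u_def)
  have L': "w < 0" "- w \<le> l" using L by (auto simp: w_def)
  have sum': "A + B \<le> T \<or> u - w \<le> l" using sum by (auto simp: A_def B_def u_def w_def)
  note g = g[unfolded folds] T(1) T(2,3)[unfolded folds]
  show ?thesis
  proof (cases "s = 1")
    case True
    have "real A * \<alpha> - 2 * of_int (int r) = u" "2 * of_int (int m) - real B * \<alpha> = - w"
      using g True by simp_all
    then show ?thesis
      using g R' L' sum' by (intro orbit_coversI[of T A B \<alpha> "int r" l "int m"]) simp_all
  next
    case False
    then have "s = -1" using sign by simp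
    have "real B * \<alpha> - 2 * of_int (int m) = - w" "2 * of_int (int r) - real A * \<alpha> = u"
      using g \<open>s = -1\<close> by simp_all
    then show ?thesis
      using g R' L' sum' by (intro orbit_coversI[of T B A \<alpha> "int m" l "int r"]) (simp_all add: add.commute)
  qed
qed

lemma not_orbit_coversI_lattice:
  fixes c :: int
  assumes "\<And>x y :: int. even (x * int P + y * int P1) \<Longrightarrow> c \<le> x * int Q + y * int Q1 \<Longrightarrow>
      x * int Q + y * int Q1 < c + int T \<Longrightarrow>
      0 < of_int x * \<eta> - of_int y * \<eta>1 \<Longrightarrow> of_int x * \<eta> - of_int y * \<eta>1 \<le> \<eta> \<Longrightarrow> False"
  shows "\<not> orbit_covers \<alpha> \<eta> T"
proof (rule not_orbit_coversI[OF sign, of c])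
  fix j e :: int
  assume a: "c \<le> j" "j < c + int T" "0 < s * (of_int j * \<alpha> - 2 * of_int e)"
    "s * (of_int j * \<alpha> - 2 * of_int e) \<le> \<eta>"
  obtain x y :: int where xy: "j = x * int Q + y * int Q1" "2 * e = x * int P + y * int P1"
    "s * (of_int j * \<alpha> - of_int (2 * e)) = of_int x * \<eta> - of_int y * \<eta>1"
    using lattice_coordinates by metis
  have "even (x * int P + y * int P1)" using xy(2) by (metis dvd_triv_left)
  moreover have "0 < of_int x * \<eta> - of_int y * \<eta>1" "of_int x * \<eta> - of_int y * \<eta>1 \<le> \<eta>"
    using a(3,4) unfolding xy(3)[symmetric] by simp_all
  ultimately show False using assms[of x y] a(1,2) unfolding xy(1) by blast
qed

section \<open>Exact covering times for each parity of the numerators\<close>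

lemma covers_even:
  fixes a :: nat
  assumes par: "even P" "odd P1" and a: "1 < a" "0 < \<eta> - real a * \<eta>1"
  shows "orbit_covers \<alpha> \<eta> (2 * Q1 + Q)" "\<not> orbit_covers \<alpha> \<eta> (2 * Q1 + Q - 1)"
proof -
  have "2 * \<eta>1 \<le> real a * \<eta>1" using a \<eta> by (intro mult_right_mono) auto
  then have \<eta>2: "2 * \<eta>1 < \<eta>" using a by linarith
  show "orbit_covers \<alpha> \<eta> (2 * Q1 + Q)"
    \<comment> \<open>The parities require \<open>y\<close> to be even. The displacements
      \<open>\<eta> - 2 * \<eta>1\<close> and \<open>2 * \<eta>1\<close> of these moves add up to
      \<open>\<eta>\<close>, so the larger of the two times suffices.\<close>
    by (rule orbit_coversI_lattice[of _ 1 2 0 2]) (use par \<eta> \<eta>2 Q_pos in auto)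
  show "\<not> orbit_covers \<alpha> \<eta> (2 * Q1 + Q - 1)"
  \<comment> \<open>The window lies strictly between the times \<open>- 2 * Q1\<close> and
    \<open>Q\<close> of the admissible coordinates \<open>(0, -2)\<close> and
    \<open>(1, 0)\<close>.\<close>
  proof (rule not_orbit_coversI_lattice[of "1 - 2 * int Q1"])
    fix x y :: int
    assume "even (x * int P + y * int P1)"
    then have y: "even y" using par by simp
    assume lo: "1 - 2 * int Q1 \<le> x * int Q + y * int Q1"
      and hi: "x * int Q + y * int Q1 < 1 - 2 * int Q1 + int (2 * Q1 + Q - 1)"
      and d: "0 < of_int x * \<eta> - of_int y * \<eta>1" "of_int x * \<eta> - of_int y * \<eta>1 \<le> \<eta>"
    have hi: "x * int Q + y * int Q1 < int Q" using hi Q_pos by simp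
    from y have "y = 0 \<or> y \<ge> 2 \<or> y \<le> -2" by presburger
    then consider "y = 0" | "y \<ge> 2" | "y \<le> -2" by blast
    then show False
    proof cases
      case 1
      then have "x > 0" using d \<eta> by (simp add: zero_less_mult_iff)
      then show False using hi mult_right_mono[of 1 x "int Q"] 1 by simp
    next
      case 2
      have "0 < of_int y * \<eta>1" "0 \<le> y * int Q1" using 2 \<eta> by auto
      then have "0 < of_int x * \<eta>" "x * int Q < int Q" using d hi by linarith+
      then show False using \<eta> mult_right_mono[of 1 x "int Q"] by (auto simp: zero_less_mult_iff)
    next
      case 3
      then have y: "y * int Q1 \<le> (-2) * int Q1" "of_int y * \<eta>1 \<le> (-2) * \<eta>1"
        using \<eta> by (intro mult_right_mono; simp; fail)+
      have "x < 1"
      proof (rule ccontr)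
        assume "\<not> x < 1"
        then have "1 * \<eta> \<le> of_int x * \<eta>" using \<eta> by (intro mult_right_mono) auto
        then show False using y d \<eta> by linarith
      qed
      then have "x * int Q \<le> 0" by (simp add: mult_nonpos_nonneg)
      then show False using lo y by linarith
    qed
  qed
qed

text \<open>The move by \<open>2 * \<eta>1\<close> is now too long. It is replaced by a backward
  move of \<open>2 * \<eta>1 - \<eta>\<close>, which together with the forward move of
  \<open>2 * \<eta> - 2 * \<eta>1\<close> again makes exactly \<open>\<eta>\<close>; the larger time
  is the answer.\<close>

lemma covers_even_1:
  assumes par: "even P" "odd P1" and \<eta>2: "\<eta> < 2 * \<eta>1"
  shows "orbit_covers \<alpha> \<eta> (2 * (Q1 + Q))" "\<not> orbit_covers \<alpha> \<eta> (2 * (Q1 + Q) - 1)"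
proof -
  show "orbit_covers \<alpha> \<eta> (2 * (Q1 + Q))"
    by (rule orbit_coversI_lattice[of _ 2 2 1 2]) (use par \<eta> \<eta>2 Q_pos in auto)
  show "\<not> orbit_covers \<alpha> \<eta> (2 * (Q1 + Q) - 1)"
  \<comment> \<open>The window lies strictly between the times of the coordinates
    \<open>(-1, -2)\<close> and \<open>(1, 0)\<close>.\<close>
  proof (rule not_orbit_coversI_lattice[of "1 - 2 * int Q1 - int Q"])
    fix x y :: int
    assume "even (x * int P + y * int P1)"
    then have y: "even y" using par by simp
    assume lo: "1 - 2 * int Q1 - int Q \<le> x * int Q + y * int Q1"
      and hi: "x * int Q + y * int Q1 < 1 - 2 * int Q1 - int Q + int (2 * (Q1 + Q) - 1)"
      and d: "0 < of_int x * \<eta> - of_int y * \<eta>1" "of_int x * \<eta> - of_int y * \<eta>1 \<le> \<eta>"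
    have hi: "x * int Q + y * int Q1 < int Q" using hi Q_pos by simp
    from y have "y = 0 \<or> y \<ge> 2 \<or> y \<le> -2" by presburger
    then consider "y = 0" | "y \<ge> 2" | "y \<le> -2" by blast
    then show False
    proof cases
      case 1
      then have "x > 0" using d \<eta> by (simp add: zero_less_mult_iff)
      then show False using hi mult_right_mono[of 1 x "int Q"] 1 by simp
    next
      case 2
      have "0 < of_int y * \<eta>1" "0 \<le> y * int Q1" using 2 \<eta> by auto
      then have "0 < of_int x * \<eta>" "x * int Q < int Q" using d hi by linarith+
      then show False using \<eta> mult_right_mono[of 1 x "int Q"] by (auto simp: zero_less_mult_iff)
    next
      case 3
      then have y: "y * int Q1 \<le> (-2) * int Q1" "of_int y * \<eta>1 \<le> (-2) * \<eta>1"
        using \<eta> by (intro mult_right_mono; simp; fail)+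
      have "x < 0"
      proof (rule ccontr)
        assume "\<not> x < 0"
        then have "0 \<le> of_int x * \<eta>" using \<eta> by auto
        then show False using y d \<eta>2 by linarith
      qed
      then have "x * int Q \<le> (-1) * int Q" by (intro mult_right_mono) auto
      then show False using lo y by linarith
    qed
  qed
qed

text \<open>The hypotheses make \<open>a\<close> the integer part of
  \<open>\<eta> / \<eta>1\<close>. Now \<open>x\<close> must be even; the forward move
  \<open>(2, a + 1)\<close> and the backward move \<open>(0, 1)\<close> together exceed
  \<open>\<eta>\<close>, so their times add.\<close>

lemma covers_odd_even:
  fixes a :: nat
  assumes par: "odd P" "even P1" and a: "1 \<le> a" "0 < \<eta> - real a * \<eta>1" "\<eta> - real a * \<eta>1 < \<eta>1"
  shows "orbit_covers \<alpha> \<eta> (2 * Q + (a + 2) * Q1)" "\<not> orbit_covers \<alpha> \<eta> (2 * Q + (a + 2) * Q1 - 1)"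
proof -
  show "orbit_covers \<alpha> \<eta> (2 * Q + (a + 2) * Q1)"
    by (rule orbit_coversI_lattice[of _ 2 "a + 1" 0 1])
      (use par a \<eta> Q_pos in \<open>auto simp: algebra_simps\<close>)
  show "\<not> orbit_covers \<alpha> \<eta> (2 * Q + (a + 2) * Q1 - 1)"
  \<comment> \<open>The window ends just before the forward time \<open>2 * Q + (a + 1) * Q1\<close>
    and begins just after the negated backward time.\<close>
  proof (rule not_orbit_coversI_lattice[of "1 - int Q1"])
    fix x y :: int
    assume "even (x * int P + y * int P1)"
    then have x: "even x" using par by simp
    assume lo: "1 - int Q1 \<le> x * int Q + y * int Q1"
      and hi: "x * int Q + y * int Q1 < 1 - int Q1 + int (2 * Q + (a + 2) * Q1 - 1)"
      and d: "0 < of_int x * \<eta> - of_int y * \<eta>1" "of_int x * \<eta> - of_int y * \<eta>1 \<le> \<eta>"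
    have hi: "x * int Q + y * int Q1 < 2 * int Q + (int a + 1) * int Q1"
      using hi Q_pos by (simp add: of_nat_diff algebra_simps)
    have neg: False if "x \<le> 0" "y < 0"
    proof -
      have "x * int Q \<le> 0" "y * int Q1 \<le> (-1) * int Q1"
        using that by (simp add: mult_nonpos_nonneg, intro mult_right_mono) auto
      then show False using lo by linarith
    qed
    from x have "x = 0 \<or> x \<ge> 2 \<or> x \<le> -2" by presburger
    then consider "x = 0" | "x \<ge> 2" | "x \<le> -2" by blast
    then show False
    proof cases
      case 1
      then have "y < 0" using d \<eta> by (simp add: mult_less_0_iff)
      then show False using neg 1 by simp
    next
      case 2
      have "real a * \<eta>1 < of_int y * \<eta>1"
      proof -
        have "1 * \<eta> \<le> of_int (x - 1) * \<eta>" using 2 \<eta> by (intro mult_right_mono) auto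
        moreover have "of_int (x - 1) * \<eta> = of_int x * \<eta> - \<eta>" by (simp add: algebra_simps)
        ultimately show ?thesis using d a by linarith
      qed
      then have "real a < of_int y" using \<eta> by simp
      then have "int a + 1 \<le> y" by linarith
      then have "(int a + 1) * int Q1 \<le> y * int Q1" by (intro mult_right_mono) auto
      moreover have "2 * int Q \<le> x * int Q" using 2 by (intro mult_right_mono) auto
      ultimately show False using hi by linarith
    next
      case 3
      then have "of_int x * \<eta> < 0" using \<eta> by (simp add: mult_less_0_iff)
      then have "of_int y * \<eta>1 < 0" using d by linarith
      then have "y < 0" using \<eta> by (simp add: mult_less_0_iff)
      then show False using neg 3 by simp
    qed
  qed
qed

text \<open>Shared by the lower bounds for two odd numerators, where \<open>x + y\<close> is even.
  If \<open>x \<ge> 1\<close>, the bound \<open>\<eta>\<close> on the displacement forces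
  \<open>y \<ge> 1\<close>, which takes time at least \<open>Q + Q1\<close>. For
  \<open>x \<le> 0\<close>, positivity and \<open>\<eta>1 < \<eta>\<close> give
  \<open>y < x\<close>, and parity widens the difference to 2.\<close>

lemma coefficients_of_positive_displacement:
  fixes x y :: int
  assumes par: "odd P" "odd P1" "even (x * int P + y * int P1)"
    and d: "0 < of_int x * \<eta> - of_int y * \<eta>1" "of_int x * \<eta> - of_int y * \<eta>1 \<le> \<eta>"
    and hi: "x * int Q + y * int Q1 < int Q + int Q1"
  shows "x \<le> 0" "y \<le> x - 2"
proof -
  have xy: "even (x + y)" using par by simp
  show x: "x \<le> 0"
  proof (rule ccontr)
    assume "\<not> x \<le> 0"
    then have "1 \<le> x" by simp
    then have "1 * \<eta> \<le> of_int x * \<eta>" using \<eta> by (intro mult_right_mono) auto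
    then have "0 \<le> of_int y * \<eta>1" using d by linarith
    then have "0 \<le> y" using \<eta> by (simp add: zero_le_mult_iff)
    have "y \<noteq> 0"
    proof
      assume "y = 0"
      then have "2 \<le> x" using xy \<open>1 \<le> x\<close> by presburger
      then have "2 * \<eta> \<le> of_int x * \<eta>" using \<eta> by (intro mult_right_mono) auto
      then show False using d \<open>y = 0\<close> \<eta> by simp
    qed
    then have "1 * int Q \<le> x * int Q" "1 * int Q1 \<le> y * int Q1"
      using \<open>0 \<le> y\<close> \<open>1 \<le> x\<close> by (intro mult_right_mono; simp)+
    then show False using hi by linarith
  qed
  have "of_int x * \<eta> \<le> of_int x * \<eta>1" using x \<eta> by (intro mult_left_mono_neg) auto
  then have "of_int y * \<eta>1 < of_int x * \<eta>1" using d by linarith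
  then have "y < x" using \<eta> by simp
  then show "y \<le> x - 2" using xy by presburger
qed

text \<open>The forward move \<open>(1, 1)\<close> and the backward move \<open>(0, 2)\<close> have
  total length \<open>\<eta> + \<eta>1\<close>, more than \<open>\<eta>\<close>, so their times
  add.\<close>

lemma covers_odd_odd:
  fixes a :: nat
  assumes par: "odd P" "odd P1" and a: "1 < a" "0 < \<eta> - real a * \<eta>1"
  shows "orbit_covers \<alpha> \<eta> (3 * Q1 + Q)" "\<not> orbit_covers \<alpha> \<eta> (3 * Q1 + Q - 1)"
proof -
  have "2 * \<eta>1 \<le> real a * \<eta>1" using a \<eta> by (intro mult_right_mono) auto
  then have \<eta>2: "2 * \<eta>1 < \<eta>" using a by linarith
  show "orbit_covers \<alpha> \<eta> (3 * Q1 + Q)"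
    by (rule orbit_coversI_lattice[of _ 1 1 0 2]) (use par \<eta> \<eta>2 Q_pos in auto)
  show "\<not> orbit_covers \<alpha> \<eta> (3 * Q1 + Q - 1)"
  proof (rule not_orbit_coversI_lattice[of "1 - 2 * int Q1"])
    fix x y :: int
    assume e: "even (x * int P + y * int P1)"
    assume lo: "1 - 2 * int Q1 \<le> x * int Q + y * int Q1"
      and hi: "x * int Q + y * int Q1 < 1 - 2 * int Q1 + int (3 * Q1 + Q - 1)"
      and d: "0 < of_int x * \<eta> - of_int y * \<eta>1" "of_int x * \<eta> - of_int y * \<eta>1 \<le> \<eta>"
    have "x * int Q + y * int Q1 < int Q + int Q1" using hi Q_pos by simp
    note xy = coefficients_of_positive_displacement[OF par e d this]
    have "x * int Q \<le> 0" "y * int Q1 \<le> (-2) * int Q1"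
      using xy by (simp add: mult_nonpos_nonneg, intro mult_right_mono) auto
    then show False using lo by linarith
  qed
qed

text \<open>The backward move \<open>(0, 2)\<close> is now longer than \<open>\<eta>\<close>.
  Combining it with copies of the forward move \<open>(1, 1)\<close> shortens it by
  \<open>\<eta> - \<eta>1\<close> each time, and \<open>b\<close>, the integer part of
  \<open>\<eta>1 / (\<eta> - \<eta>1)\<close>, is the least number of copies that brings it down to
  \<open>\<eta>\<close>.\<close>

lemma covers_odd_odd_1:
  fixes b :: nat
  assumes par: "odd P" "odd P1" and \<eta>2: "\<eta> < 2 * \<eta>1"
    and b: "1 \<le> b" "0 < \<eta>1 - real b * (\<eta> - \<eta>1)" "\<eta>1 - real b * (\<eta> - \<eta>1) < \<eta> - \<eta>1"
  shows "orbit_covers \<alpha> \<eta> ((b + 1) * (Q1 + Q) + 2 * Q1)"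
    "\<not> orbit_covers \<alpha> \<eta> ((b + 1) * (Q1 + Q) + 2 * Q1 - 1)"
proof -
  show "orbit_covers \<alpha> \<eta> ((b + 1) * (Q1 + Q) + 2 * Q1)"
    by (rule orbit_coversI_lattice[of _ 1 1 b "b + 2"])
      (use par \<eta> \<eta>2 b Q_pos in \<open>auto simp: algebra_simps\<close>)
  show "\<not> orbit_covers \<alpha> \<eta> ((b + 1) * (Q1 + Q) + 2 * Q1 - 1)"
  proof (rule not_orbit_coversI_lattice[of "1 - int b * int Q - (int b + 2) * int Q1"])
    fix x y :: int
    assume e: "even (x * int P + y * int P1)"
    assume lo: "1 - int b * int Q - (int b + 2) * int Q1 \<le> x * int Q + y * int Q1"
      and hi: "x * int Q + y * int Q1
        < 1 - int b * int Q - (int b + 2) * int Q1 + int ((b + 1) * (Q1 + Q) + 2 * Q1 - 1)"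
      and d: "0 < of_int x * \<eta> - of_int y * \<eta>1" "of_int x * \<eta> - of_int y * \<eta>1 \<le> \<eta>"
    have "x * int Q + y * int Q1 < int Q + int Q1"
      using hi Q_pos by (simp add: of_nat_diff algebra_simps)
    note xy = coefficients_of_positive_displacement[OF par e d this]
    have "\<eta>1 \<le> of_int (1 - x) * (\<eta> - \<eta>1)"
    proof -
      have "of_int y * \<eta>1 \<le> of_int (x - 2) * \<eta>1" using xy \<eta> by (intro mult_right_mono) auto
      then show ?thesis using d by (simp add: algebra_simps)
    qed
    then have "real b * (\<eta> - \<eta>1) < of_int (1 - x) * (\<eta> - \<eta>1)" using b by linarith
    then have "real b < of_int (1 - x)" using \<eta> by (simp add: mult_less_cancel_right)
    then have x: "x \<le> - int b" by linarith
    then have y: "y \<le> - (int b + 2)" using xy by linarith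
    have "x * int Q \<le> - int b * int Q" using x by (intro mult_right_mono) auto
    moreover have "y * int Q1 \<le> - (int b + 2) * int Q1" using y by (intro mult_right_mono) auto
    ultimately show False using lo by (simp add: algebra_simps)
  qed
qed

lemma not_both_even: "odd P \<or> odd P1"
proof (rule ccontr)
  assume "\<not> ?thesis"
  then have "even (int P1 * int Q - int P * int Q1)" by simp
  then show False using det by (metis even_minus odd_one)
qed

text \<open>Doubling a move makes its numerator even whatever the parities are. This serves to show
  that the orbit is dense.\<close>

lemma covers_twice: "orbit_covers \<alpha> (2 * \<eta>) (2 * Q + 2 * Q1)"
  by (rule orbit_coversI_lattice[of _ 2 0 0 2]) (use \<eta> Q_pos in auto)

end

section \<open>Factors of Rote sequences as codings of a rotation\<close>

lemma snth_equalityI: "(\<And>i. s !! i = t !! i) \<Longrightarrow> s = t"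
  by (metis ext stream_smap_nats)

lemma stake_eq_stake_iff: "stake n s = stake n t \<longleftrightarrow> (\<forall>i<n. s !! i = t !! i)"
  by (metis length_stake nth_equalityI stake_nth)

lemma sublist_stake_iff:
  assumes "length x = m"
  shows "sublist x (stake M s) \<longleftrightarrow> (\<exists>k. k + m \<le> M \<and> x = stake m (sdrop k s))"
proof
  assume "sublist x (stake M s)"
  then obtain p q where pq: "stake M s = p @ x @ q" by (auto simp: sublist_def)
  then have len: "length p + m + length q = M"
    using assms by (metis length_append length_stake add.assoc)
  have "x = take m (drop (length p) (stake M s))" using pq assms by simp
  also have "\<dots> = stake m (sdrop (length p) s)" using len by (simp add: drop_stake take_stake)
  finally show "\<exists>k. k + m \<le> M \<and> x = stake m (sdrop k s)"
    using len by (intro exI[of _ "length p"]) simp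
next
  assume "\<exists>k. k + m \<le> M \<and> x = stake m (sdrop k s)"
  then obtain k where k: "k + m \<le> M" "x = stake m (sdrop k s)" by blast
  have "stake M s = stake k s @ x @ stake (M - k - m) (sdrop m (sdrop k s))"
    using k by (simp del: sdrop_add)
  then show "sublist x (stake M s)" by (metis sublist_appendI)
qed

lemma of_int_bit_eq_iff: "(of_int a :: bit) = of_int b \<longleftrightarrow> even (a - b)"
proof -
  have "(of_int c :: bit) = 0 \<longleftrightarrow> even c" for c
  proof (cases "even c")
    case True
    then obtain k where "c = 2 * k" by blast
    then show ?thesis by simp
  next
    case False
    then obtain k where "c = 2 * k + 1" by (elim oddE)
    then show ?thesis by simp
  qed
  from this[of "a - b"] show ?thesis by (simp only: of_int_diff right_minus_eq)
qed

lemma bit_add_cancel: "b = d + e" if "a + b = c + d" "a = c + e" for a b c d e :: bit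
  using that by (cases "a = 0"; cases "b = 0"; cases "c = 0"; cases "d = 0") simp_all

section \<open>Codings of a rotation by parities of integer parts\<close>

definition parity_coding :: "real \<Rightarrow> real \<Rightarrow> bit stream" where
  "parity_coding \<alpha> z = smap (\<lambda>i. of_int \<lfloor>z + real i * \<alpha>\<rfloor>) nats"

lemma funpow_Suc_zero: "(Suc ^^ i) 0 = i"
  by (induction i) auto

lemma snth_parity_coding [simp]: "parity_coding \<alpha> z !! i = of_int \<lfloor>z + real i * \<alpha>\<rfloor>"
  by (simp add: parity_coding_def funpow_Suc_zero)

lemma sdrop_parity_coding: "sdrop k (parity_coding \<alpha> z) = parity_coding \<alpha> (z + real k * \<alpha>)"
  by (rule snth_equalityI) (simp add: sdrop_snth algebra_simps)

lemma parity_coding_add_even: "parity_coding \<alpha> (z + 2 * of_int e) = parity_coding \<alpha> z"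
proof (rule snth_equalityI)
  fix i
  have "z + 2 * of_int e + real i * \<alpha> = z + real i * \<alpha> + of_int (2 * e)" by simp
  then have "\<lfloor>z + 2 * of_int e + real i * \<alpha>\<rfloor> = \<lfloor>z + real i * \<alpha>\<rfloor> + 2 * e"
    by (metis floor_add_int)
  then show "parity_coding \<alpha> (z + 2 * of_int e) !! i = parity_coding \<alpha> z !! i"
    by (simp add: of_int_bit_eq_iff)
qed

lemma parity_coding_add_one: "parity_coding \<alpha> (z + 1) = smap (\<lambda>x. x + 1) (parity_coding \<alpha> z)"
proof (rule snth_equalityI)
  fix i
  have "z + 1 + real i * \<alpha> = z + real i * \<alpha> + of_int 1" by simp
  then have "\<lfloor>z + 1 + real i * \<alpha>\<rfloor> = \<lfloor>z + real i * \<alpha>\<rfloor> + 1" by (metis floor_add_int)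
  then show "parity_coding \<alpha> (z + 1) !! i = smap (\<lambda>x. x + 1) (parity_coding \<alpha> z) !! i"
    by simp
qed

lemma stake_parity_coding_eq_iff:
  "stake m (parity_coding \<alpha> x) = stake m (parity_coding \<alpha> y) \<longleftrightarrow>
     (\<forall>j<m. even (\<lfloor>x + real j * \<alpha>\<rfloor> - \<lfloor>y + real j * \<alpha>\<rfloor>))"
  by (simp add: stake_eq_stake_iff of_int_bit_eq_iff)

text \<open>All floors agree with those of \<open>x\<close> on the intersection of the intervals
  \<open>[lo j, lo j + 1)\<close>. Its length is either 1 or a positive value
  \<open>k * \<alpha> - m\<close> with \<open>0 < \<bar>k\<bar> \<le> n\<close>, hence at least
  \<open>l\<close> by \<open>sep\<close>.\<close>

lemma cell_contains_arc:
  assumes l: "l \<le> 1"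
    and sep: "\<And>j m :: int. j \<noteq> 0 \<Longrightarrow> \<bar>j\<bar> \<le> int n \<Longrightarrow> l \<le> \<bar>of_int j * \<alpha> - of_int m\<bar>"
  obtains c where "\<And>z. c \<le> z \<Longrightarrow> z < c + l \<Longrightarrow>
    stake (n + 1) (parity_coding \<alpha> z) = stake (n + 1) (parity_coding \<alpha> x)"
proof -
  define lo where "lo j = of_int \<lfloor>x + real j * \<alpha>\<rfloor> - real j * \<alpha>" for j :: nat
  have lo: "lo j \<le> x" "x < lo j + 1" for j
    using of_int_floor_le[of "x + real j * \<alpha>"] floor_correct[of "x + real j * \<alpha>"]
    unfolding lo_def by linarith+
  define c where "c = Max (lo ` {..n})"
  have "c \<in> lo ` {..n}" unfolding c_def by (intro Max_in) auto
  then obtain j' where j': "j' \<le> n" "c = lo j'" by auto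
  have ge: "lo j \<le> c" if "j \<le> n" for j using that unfolding c_def by simp
  have le: "c + l \<le> lo j + 1" if "j \<le> n" for j
  proof (cases "j = j'")
    case True
    then show ?thesis using j' l by simp
  next
    case False
    have "l \<le> \<bar>of_int (int j' - int j) * \<alpha> - of_int (\<lfloor>x + real j' * \<alpha>\<rfloor> - \<lfloor>x + real j * \<alpha>\<rfloor> - 1)\<bar>"
      using False j' that by (intro sep) auto
    also have "of_int (int j' - int j) * \<alpha> - of_int (\<lfloor>x + real j' * \<alpha>\<rfloor> - \<lfloor>x + real j * \<alpha>\<rfloor> - 1)
        = lo j + 1 - lo j'"
      by (simp add: lo_def algebra_simps)
    finally show ?thesis using lo(1)[of j'] lo(2)[of j] j' by linarith
  qed
  show ?thesis
  proof (rule that)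
    fix z assume z: "c \<le> z" "z < c + l"
    have "\<lfloor>z + real j * \<alpha>\<rfloor> = \<lfloor>x + real j * \<alpha>\<rfloor>" if "j \<le> n" for j
    proof (rule floor_unique)
      show "of_int \<lfloor>x + real j * \<alpha>\<rfloor> \<le> z + real j * \<alpha>"
        using z ge[OF that] by (simp add: lo_def)
      show "z + real j * \<alpha> < of_int \<lfloor>x + real j * \<alpha>\<rfloor> + 1"
        using z le[OF that] unfolding lo_def by linarith
    qed
    then show "stake (n + 1) (parity_coding \<alpha> z) = stake (n + 1) (parity_coding \<alpha> x)"
      unfolding stake_parity_coding_eq_iff by simp
  qed
qed

text \<open>The positions 0 and \<open>Q\<close> of the word suffice: modulo 1 their breakpoints
  differ by \<open>l\<close>, and they enclose the arc \<open>[-l, 0)\<close> or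
  \<open>[0, l)\<close> according to the sign \<open>s\<close>.\<close>

lemma cell_within_arc:
  fixes P Q n :: nat
  assumes l: "0 < l" "l \<le> 1" and Q: "Q \<le> n" and s: "s = 1 \<or> s = -1" "s * (real Q * \<alpha> - real P) = l"
  obtains c x where "\<And>z. stake (n + 1) (parity_coding \<alpha> z) = stake (n + 1) (parity_coding \<alpha> x)
    \<Longrightarrow> \<exists>e::int. c \<le> z - 2 * of_int e \<and> z - 2 * of_int e < c + l"
proof (cases "s = 1")
  case True
  then have Qa: "real Q * \<alpha> = l + of_int (int P)" using s by simp
  show ?thesis
  proof (rule that[of "- l" "- l"])
    fix z assume "stake (n + 1) (parity_coding \<alpha> z) = stake (n + 1) (parity_coding \<alpha> (- l))"
    then have par: "even (\<lfloor>z + real j * \<alpha>\<rfloor> - \<lfloor>- l + real j * \<alpha>\<rfloor>)" if "j \<le> n" for j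
      unfolding stake_parity_coding_eq_iff using that by simp
    have "\<lfloor>- l\<rfloor> = -1" using l by (intro floor_unique) auto
    then have z: "odd \<lfloor>z\<rfloor>" using par[of 0] by simp
    have "z + real Q * \<alpha> = z + l + of_int (int P)" "- l + real Q * \<alpha> = of_int (int P)"
      using Qa by simp_all
    then have "\<lfloor>z + real Q * \<alpha>\<rfloor> = \<lfloor>z + l\<rfloor> + int P" "\<lfloor>- l + real Q * \<alpha>\<rfloor> = int P"
      by (simp_all only: floor_add_int floor_of_int)
    then have zl: "even \<lfloor>z + l\<rfloor>" using par[OF Q] by simp
    from z obtain e where e: "\<lfloor>z\<rfloor> = 2 * e + 1" by (elim oddE)
    have "\<lfloor>z + l\<rfloor> \<noteq> 2 * e + 1" using zl by auto
    moreover have "2 * of_int e + 1 \<le> z" "z < 2 * of_int e + 2"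
      using e by (auto simp: floor_eq_iff)
    ultimately have "2 * of_int e + 2 \<le> z + l" using l by (auto simp: floor_eq_iff)
    then show "\<exists>e::int. - l \<le> z - 2 * of_int e \<and> z - 2 * of_int e < - l + l"
      using \<open>z < 2 * of_int e + 2\<close> by (intro exI[of _ "e + 1"]) simp
  qed
next
  case False
  then have Qa: "real Q * \<alpha> = - l + of_int (int P)" using s by simp
  show ?thesis
  proof (rule that[of 0 0])
    fix z assume "stake (n + 1) (parity_coding \<alpha> z) = stake (n + 1) (parity_coding \<alpha> 0)"
    then have par: "even (\<lfloor>z + real j * \<alpha>\<rfloor> - \<lfloor>0 + real j * \<alpha>\<rfloor>)" if "j \<le> n" for j
      unfolding stake_parity_coding_eq_iff using that by simp
    have l1: "\<lfloor>- l\<rfloor> = -1" using l by (intro floor_unique) auto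
    have z: "even \<lfloor>z\<rfloor>" using par[of 0] by simp
    have "z + real Q * \<alpha> = z - l + of_int (int P)" "0 + real Q * \<alpha> = - l + of_int (int P)"
      using Qa by simp_all
    then have "\<lfloor>z + real Q * \<alpha>\<rfloor> = \<lfloor>z - l\<rfloor> + int P" "\<lfloor>0 + real Q * \<alpha>\<rfloor> = -1 + int P"
      by (simp_all only: floor_add_int l1[symmetric])
    then have zl: "odd \<lfloor>z - l\<rfloor>" using par[OF Q] by simp
    from z obtain e where e: "\<lfloor>z\<rfloor> = 2 * e" by (elim evenE)
    have "\<lfloor>z - l\<rfloor> \<noteq> 2 * e" using zl by auto
    moreover have "2 * of_int e \<le> z" "z < 2 * of_int e + 1"
      using e by (auto simp: floor_eq_iff)
    ultimately have "z - l < 2 * of_int e" using l by (auto simp: floor_eq_iff)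
    then show "\<exists>e::int. 0 \<le> z - 2 * of_int e \<and> z - 2 * of_int e < 0 + l"
      using \<open>2 * of_int e \<le> z\<close> by (intro exI[of _ e]) simp
  qed
qed

text \<open>A word of length \<open>T + n\<close> has \<open>T\<close> starting positions for
  factors of length \<open>n + 1\<close>. Every cell contains an arc of length \<open>l\<close>,
  which gives the upper bound; some cell lies within such an arc, which gives the lower one.\<close>

lemma recurrence_function_eqI:
  fixes P Q n :: nat
  assumes fac: "\<And>m. factors v m = range (\<lambda>z. stake m (parity_coding \<alpha> z))"
    and l: "0 < l" "l \<le> 1"
    and sep: "\<And>j m :: int. j \<noteq> 0 \<Longrightarrow> \<bar>j\<bar> \<le> int n \<Longrightarrow> l \<le> \<bar>of_int j * \<alpha> - of_int m\<bar>"
    and Q: "Q \<le> n" "s = 1 \<or> s = -1" "s * (real Q * \<alpha> - real P) = l"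
    and cov: "orbit_covers \<alpha> l T" "\<not> orbit_covers \<alpha> l (T - 1)"
  shows "recurrence_function v (n + 1) = T + n"
  unfolding recurrence_function_def
proof (rule Least_equality)
  show "\<forall>w\<in>factors v (T + n). \<forall>x\<in>factors v (n + 1). sublist x w"
  proof (intro ballI)
    fix w x assume "w \<in> factors v (T + n)" "x \<in> factors v (n + 1)"
    then obtain z y where w: "w = stake (T + n) (parity_coding \<alpha> z)"
      and x: "x = stake (n + 1) (parity_coding \<alpha> y)" unfolding fac by auto
    obtain c where c: "\<And>z. c \<le> z \<Longrightarrow> z < c + l \<Longrightarrow>
        stake (n + 1) (parity_coding \<alpha> z) = stake (n + 1) (parity_coding \<alpha> y)"
      using cell_contains_arc[OF l(2) sep] by blast
    obtain k and e :: int where k: "k < T"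
      "c - z \<le> real k * \<alpha> + 2 * of_int e" "real k * \<alpha> + 2 * of_int e < c - z + l"
      using cov(1) unfolding orbit_covers_def by blast
    then have "stake (n + 1) (parity_coding \<alpha> (z + real k * \<alpha> + 2 * of_int e)) = x"
      unfolding x by (intro c) auto
    then have "x = stake (n + 1) (sdrop k (parity_coding \<alpha> z))"
      by (simp add: parity_coding_add_even sdrop_parity_coding)
    moreover have "length x = n + 1" by (simp add: x)
    moreover have "k + (n + 1) \<le> T + n" using k(1) by simp
    ultimately show "sublist x w" unfolding w by (subst sublist_stake_iff) auto
  qed
next
  fix M assume M: "\<forall>w\<in>factors v M. \<forall>x\<in>factors v (n + 1). sublist x w"
  show "T + n \<le> M"
  proof (rule ccontr)
    assume "\<not> T + n \<le> M"
    obtain y where y: "\<And>k e. k < T - 1 \<Longrightarrow>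
        y \<le> real k * \<alpha> + 2 * of_int e \<Longrightarrow> real k * \<alpha> + 2 * of_int e < y + l \<Longrightarrow> False"
      using cov(2) unfolding orbit_covers_def by blast
    obtain c x where c: "\<And>z. stake (n + 1) (parity_coding \<alpha> z) = stake (n + 1) (parity_coding \<alpha> x)
        \<Longrightarrow> \<exists>e::int. c \<le> z - 2 * of_int e \<and> z - 2 * of_int e < c + l"
      using cell_within_arc[OF l Q] by blast
    \<comment> \<open>Starting at \<open>c - y\<close> translates the missed arc at \<open>y\<close>
      onto the arc at \<open>c\<close> that encloses the small cell.\<close>
    have "sublist (stake (n + 1) (parity_coding \<alpha> x)) (stake M (parity_coding \<alpha> (c - y)))"
      using M unfolding fac by blast
    then obtain k where k: "k + (n + 1) \<le> M"
      "stake (n + 1) (parity_coding \<alpha> x) = stake (n + 1) (sdrop k (parity_coding \<alpha> (c - y)))"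
      by (subst (asm) sublist_stake_iff[OF length_stake]) blast
    obtain e :: int where "c \<le> c - y + real k * \<alpha> - 2 * of_int e"
      "c - y + real k * \<alpha> - 2 * of_int e < c + l"
      using c[of "c - y + real k * \<alpha>"] k(2) by (auto simp only: sdrop_parity_coding)
    moreover have "k < T - 1" using k(1) \<open>\<not> T + n \<le> M\<close> by linarith
    ultimately show False using y[of k "- e"] by auto
  qed
qed

section \<open>From sums of adjacent letters back to Rote sequences\<close>

lemma factors_eq_language: "factors s n = {w \<in> language s. length w = n}"
  by (auto simp: language_def factors_def)

lemma snth_sum_stream [simp]: "sum_stream s !! i = s !! i + s !! Suc i"
  by (simp add: sum_stream_def)

lemma sdrop_sum_stream: "sdrop k (sum_stream s) = sum_stream (sdrop k s)"
  by (rule snth_equalityI) (simp add: sdrop_snth)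

text \<open>Equal sums of adjacent letters keep the difference of the two words constant; it is 0 or
  1.\<close>

lemma stake_eq_if_sum_stream_eq:
  assumes "stake k (sum_stream s) = stake k (sum_stream t)"
  shows "stake (Suc k) s = stake (Suc k) t \<or> stake (Suc k) s = map (\<lambda>x. x + 1) (stake (Suc k) t)"
proof -
  have step: "s !! i = t !! i + (shd s - shd t)" if "i \<le> k" for i
    using that
  proof (induction i)
    case (Suc i)
    then have "sum_stream s !! i = sum_stream t !! i"
      using assms unfolding stake_eq_stake_iff by (simp del: snth_sum_stream)
    then have "s !! i + s !! Suc i = t !! i + t !! Suc i" unfolding snth_sum_stream .
    moreover have "s !! i = t !! i + (shd s - shd t)" using Suc by simp
    ultimately show ?case by (rule bit_add_cancel)
  qed (metis add.commute diff_add_cancel snth.simps(1))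
  show ?thesis
  proof (cases "shd s = shd t")
    case True
    then show ?thesis using step unfolding stake_eq_stake_iff by simp
  next
    case False
    then have "shd s - shd t = 1" by (cases "shd s = 0"; cases "shd t = 0") simp_all
    then have "stake (Suc k) s = stake (Suc k) (smap (\<lambda>x. x + 1) t)"
      using step unfolding stake_eq_stake_iff by simp
    then show ?thesis unfolding stake_smap ..
  qed
qed

text \<open>The floor function is right continuous. The one-sided neighbourhood fits the half-open
  arcs of \<open>orbit_covers\<close>.\<close>

lemma parity_coding_right_continuous:
  obtains \<epsilon> where "0 < \<epsilon>"
    "\<And>z'. z \<le> z' \<Longrightarrow> z' < z + \<epsilon> \<Longrightarrow> stake m (parity_coding \<alpha> z') = stake m (parity_coding \<alpha> z)"
proof -
  have "\<exists>\<epsilon>>0. \<forall>j<m. z + real j * \<alpha> + \<epsilon> \<le> of_int \<lfloor>z + real j * \<alpha>\<rfloor> + 1"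
  proof (induction m)
    case (Suc m)
    then obtain \<epsilon> where \<epsilon>: "0 < \<epsilon>" "\<And>j. j < m \<Longrightarrow> z + real j * \<alpha> + \<epsilon> \<le> of_int \<lfloor>z + real j * \<alpha>\<rfloor> + 1"
      by blast
    define d where "d = of_int \<lfloor>z + real m * \<alpha>\<rfloor> + 1 - (z + real m * \<alpha>)"
    have "0 < d" unfolding d_def by linarith
    then have "0 < min \<epsilon> d" using \<epsilon> by simp
    moreover have "z + real j * \<alpha> + min \<epsilon> d \<le> of_int \<lfloor>z + real j * \<alpha>\<rfloor> + 1" if "j < Suc m" for j
    proof (cases "j = m")
      case True
      then show ?thesis unfolding min_def d_def by auto
    next
      case False
      then show ?thesis using \<epsilon>(2)[of j] that by linarith
    qed
    ultimately show ?case by blast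
  qed (auto intro: exI[of _ 1])
  then obtain \<epsilon> where \<epsilon>: "0 < \<epsilon>" "\<And>j. j < m \<Longrightarrow> z + real j * \<alpha> + \<epsilon> \<le> of_int \<lfloor>z + real j * \<alpha>\<rfloor> + 1"
    by blast
  show ?thesis
  proof (rule that[OF \<epsilon>(1)])
    fix z' assume z': "z \<le> z'" "z' < z + \<epsilon>"
    have "\<lfloor>z' + real j * \<alpha>\<rfloor> = \<lfloor>z + real j * \<alpha>\<rfloor>" if "j < m" for j
      using z' \<epsilon>(2)[OF that] of_int_floor_le[of "z + real j * \<alpha>"] by (intro floor_unique) linarith+
    then show "stake m (parity_coding \<alpha> z') = stake m (parity_coding \<alpha> z)"
      unfolding stake_parity_coding_eq_iff by simp
  qed
qed

text \<open>Sums of adjacent letters determine a word up to complement. Among the codings the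
  complement is the half turn to \<open>z + 1\<close>; in \<open>v\<close> it is available by
  symmetry.\<close>

lemma factors_eq_parity_codings:
  assumes sym: "complementary_symmetric v"
    and lang: "language (sum_stream v) = language (sum_stream (parity_coding \<alpha> \<alpha>))"
    and dense: "\<And>l. 0 < l \<Longrightarrow> \<exists>T. orbit_covers \<alpha> l T"
  shows "factors v m = range (\<lambda>z. stake m (parity_coding \<alpha> z))"
proof (cases m)
  case 0
  then show ?thesis by (auto simp: factors_def)
next
  case (Suc k)
  let ?u = "sum_stream (parity_coding \<alpha> \<alpha>)"
  have fac: "factors (sum_stream v) k = factors ?u k" using lang by (simp add: factors_eq_language)
  show ?thesis
  proof (intro equalityI subsetI)
    fix w assume "w \<in> factors v m"
    then obtain i where w: "w = stake m (sdrop i v)" by (auto simp: factors_def)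
    have "stake k (sum_stream (sdrop i v)) \<in> factors ?u k"
      unfolding fac[symmetric] by (auto simp: factors_def sdrop_sum_stream)
    then obtain i' where
      "stake k (sum_stream (sdrop i v)) = stake k (sum_stream (parity_coding \<alpha> (\<alpha> + real i' * \<alpha>)))"
      by (auto simp: factors_def sdrop_sum_stream sdrop_parity_coding)
    from stake_eq_if_sum_stream_eq[OF this]
    have "w = stake m (parity_coding \<alpha> (\<alpha> + real i' * \<alpha>)) \<or>
        w = stake m (parity_coding \<alpha> (\<alpha> + real i' * \<alpha> + 1))"
      unfolding w Suc parity_coding_add_one stake_smap .
    then show "w \<in> range (\<lambda>z. stake m (parity_coding \<alpha> z))" by blast
  next
    fix w assume "w \<in> range (\<lambda>z. stake m (parity_coding \<alpha> z))"
    then obtain z where w: "w = stake m (parity_coding \<alpha> z)" by blast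
    \<comment> \<open>An arbitrary \<open>z\<close> is replaced by a point of the orbit of
      \<open>\<alpha>\<close> slightly to its right, so that the word of sums occurs in
      \<open>?u\<close>.\<close>
    obtain \<epsilon> where \<epsilon>: "0 < \<epsilon>"
      "\<And>z'. z \<le> z' \<Longrightarrow> z' < z + \<epsilon> \<Longrightarrow> stake m (parity_coding \<alpha> z') = stake m (parity_coding \<alpha> z)"
      using parity_coding_right_continuous by blast
    obtain j and e :: int where
      "z - \<alpha> \<le> real j * \<alpha> + 2 * of_int e" "real j * \<alpha> + 2 * of_int e < z - \<alpha> + \<epsilon>"
      using dense[OF \<epsilon>(1)] unfolding orbit_covers_def by blast
    then have "stake m (parity_coding \<alpha> (\<alpha> + real j * \<alpha> + 2 * of_int e)) = w"
      unfolding w by (intro \<epsilon>(2)) auto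
    then have w: "w = stake (Suc k) (parity_coding \<alpha> (\<alpha> + real j * \<alpha>))"
      unfolding Suc parity_coding_add_even by simp
    have "stake k (sum_stream (parity_coding \<alpha> (\<alpha> + real j * \<alpha>))) \<in> factors (sum_stream v) k"
      unfolding fac by (auto simp: factors_def sdrop_sum_stream simp flip: sdrop_parity_coding)
    then obtain i where
      "stake k (sum_stream (parity_coding \<alpha> (\<alpha> + real j * \<alpha>))) = stake k (sum_stream (sdrop i v))"
      by (auto simp: factors_def sdrop_sum_stream)
    from stake_eq_if_sum_stream_eq[OF this]
    have "w = stake m (sdrop i v) \<or> w = map (\<lambda>x. x + 1) (stake m (sdrop i v))"
      unfolding w Suc .
    moreover have "stake m (sdrop i v) \<in> language v" by (auto simp: language_def factors_def)
    ultimately have "w \<in> language v" using sym by (auto simp: complementary_symmetric_def)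
    then show "w \<in> factors v m" by (simp add: factors_eq_language w Suc)
  qed
qed

section \<open>Directive sequences and interval exchanges\<close>

lemma apply_morphism_Stream: "apply_morphism f (x ## u) = letter_image f x @- apply_morphism f u"
  by (cases f) (auto simp: apply_morphism_def)

text \<open>Every letter image begins with the same letter, so the common prefix gains at least one
  letter. Hence a directive sequence determines its stream, whatever the desubstituted
  streams are.\<close>

lemma apply_morphism_common_prefix:
  "stake n s = stake n t \<Longrightarrow> stake (Suc n) (apply_morphism f s) = stake (Suc n) (apply_morphism f t)"
proof (induction n arbitrary: s t)
  case 0
  show ?case
    by (cases s; cases t; cases f) (auto simp: apply_morphism_Stream)
next
  case (Suc n)
  obtain x s' t' where st: "s = x ## s'" "t = x ## t'"
    using Suc.prems by (cases s; cases t) auto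
  then have IH: "stake (Suc n) (apply_morphism f s') = stake (Suc n) (apply_morphism f t')"
    using Suc by (intro Suc.IH) simp
  then have "stake n (apply_morphism f s') = stake n (apply_morphism f t')"
    unfolding stake_eq_stake_iff by simp
  then show ?case unfolding st apply_morphism_Stream using IH by (cases f) simp_all
qed

lemma foldr_apply_morphism_common_prefix:
  "stake (length w) (foldr apply_morphism w s) = stake (length w) (foldr apply_morphism w t)"
proof (induction w)
  case (Cons f w)
  then show ?case
    unfolding foldr.simps comp_apply length_Cons by (rule apply_morphism_common_prefix)
qed simp

lemma directive_sequence_unique:
  assumes "\<And>n. \<exists>s. u = foldr apply_morphism (stake n \<Delta>) s"
    and "\<And>n. \<exists>s. u' = foldr apply_morphism (stake n \<Delta>) s"
  shows "u = u'"
proof (rule snth_equalityI)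
  fix i
  have "stake (Suc i) u = stake (Suc i) u'"
  proof -
    obtain s s' where "u = foldr apply_morphism (stake (Suc i) \<Delta>) s"
      "u' = foldr apply_morphism (stake (Suc i) \<Delta>) s'"
      using assms[of "Suc i"] by (elim exE)
    then show ?thesis
      using foldr_apply_morphism_common_prefix[of "stake (Suc i) \<Delta>" s s'] by (simp only: length_stake)
  qed
  then show "u !! i = u' !! i" unfolding stake_eq_stake_iff by simp
qed

section \<open>Morphisms as induced maps of two-interval exchanges\<close>

lemma apply_morphism_siterateI:
  assumes step: "\<And>y. I y \<Longrightarrow> I (t y) \<and> s y = letter_image f (c y) @- s (t y)" and "I y"
  shows "s y = apply_morphism f (smap c (siterate t y))"
proof (rule snth_equalityI)
  fix i
  show "s y !! i = apply_morphism f (smap c (siterate t y)) !! i"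
    using \<open>I y\<close>
  proof (induction i arbitrary: y rule: less_induct)
    case (less i)
    let ?L = "letter_image f (c y)"
    have "smap c (siterate t y) = c y ## smap c (siterate t (t y))"
      by (subst siterate.code) simp
    then have eq: "apply_morphism f (smap c (siterate t y)) = ?L @- apply_morphism f (smap c (siterate t (t y)))"
      by (simp add: apply_morphism_Stream)
    \<comment> \<open>Nonempty blocks make the position in the remaining stream smaller, as the
      strong induction needs.\<close>
    have L: "length ?L > 0" by (cases f) auto
    from step[OF less.prems] have t: "I (t y)" and s: "s y = ?L @- s (t y)" by auto
    show ?case
    proof (cases "i < length ?L")
      case True
      then show ?thesis by (subst s, subst eq) simp
    next
      case False
      then have "i - length ?L < i" using L by linarith
      from less.IH[OF this t] show ?thesis using False by (subst s, subst eq) simp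
    qed
  qed
qed

text \<open>On \<open>[0, p + q)\<close> this is the rotation by \<open>q\<close> modulo
  \<open>p + q\<close>.\<close>

definition interval_exchange :: "real \<Rightarrow> real \<Rightarrow> real \<Rightarrow> real" where
  "interval_exchange p q x = (if x < p then x + q else x - p)"

definition exchange_letter :: "real \<Rightarrow> real \<Rightarrow> bit" where
  "exchange_letter p x = (if x < p then 0 else 1)"

definition exchange_coding :: "real \<Rightarrow> real \<Rightarrow> real \<Rightarrow> bit stream" where
  "exchange_coding p q x = smap (exchange_letter p) (siterate (interval_exchange p q) x)"

lemma exchange_coding_Stream:
  "exchange_coding p q x = exchange_letter p x ## exchange_coding p q (interval_exchange p q x)"
  unfolding exchange_coding_def by (subst siterate.code) simp

text \<open>The smaller exchange is the first return map to \<open>[p, p + q)\<close>, translated by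
  \<open>p\<close>. For \<open>y < p\<close> the orbit passes once through \<open>[0, p)\<close>,
  spelling 10; otherwise it returns at once, spelling 1.\<close>

lemma exchange_coding_G:
  assumes "0 < p" "p < q" "0 \<le> y" "y < q"
  shows "exchange_coding p q (y + p) = apply_morphism G (exchange_coding p (q - p) y)"
  unfolding exchange_coding_def[of p "q - p"]
proof (rule apply_morphism_siterateI[where I = "\<lambda>y. 0 \<le> y \<and> y < q" and s = "\<lambda>y. exchange_coding p q (y + p)"])
  fix y assume y: "0 \<le> y \<and> y < q"
  then have "0 \<le> interval_exchange p (q - p) y \<and> interval_exchange p (q - p) y < q"
    using assms by (auto simp: interval_exchange_def)
  moreover have "exchange_coding p q (y + p) = letter_image G (exchange_letter p y) @-
      exchange_coding p q (interval_exchange p (q - p) y + p)"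
  proof (cases "y < p")
    case True
    then show ?thesis using y assms
      by (subst exchange_coding_Stream, subst exchange_coding_Stream)
        (simp add: interval_exchange_def exchange_letter_def)
  next
    case False
    then show ?thesis using y assms
      by (subst exchange_coding_Stream) (simp add: interval_exchange_def exchange_letter_def)
  qed
  ultimately show "(0 \<le> interval_exchange p (q - p) y \<and> interval_exchange p (q - p) y < q) \<and>
    exchange_coding p q (y + p) = letter_image G (exchange_letter p y) @-
      exchange_coding p q (interval_exchange p (q - p) y + p)" by blast
qed (use assms in simp)

text \<open>The smaller exchange is the first return map to \<open>[0, p)\<close>. For
  \<open>y < p - q\<close> the return is immediate, spelling 0; otherwise the orbit passes through
  \<open>[p, p + q)\<close>, spelling 01.\<close>

lemma exchange_coding_D:
  assumes "0 < q" "q < p" "0 \<le> y" "y < p"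
  shows "exchange_coding p q y = apply_morphism D (exchange_coding (p - q) q y)"
  unfolding exchange_coding_def[of "p - q" q]
proof (rule apply_morphism_siterateI[where I = "\<lambda>y. 0 \<le> y \<and> y < p" and s = "\<lambda>y. exchange_coding p q y"])
  fix y assume y: "0 \<le> y \<and> y < p"
  then have "0 \<le> interval_exchange (p - q) q y \<and> interval_exchange (p - q) q y < p"
    using assms by (auto simp: interval_exchange_def)
  moreover have "exchange_coding p q y = letter_image D (exchange_letter (p - q) y) @-
      exchange_coding p q (interval_exchange (p - q) q y)"
  proof (cases "y < p - q")
    case True
    then show ?thesis using y assms
      by (subst exchange_coding_Stream) (simp add: interval_exchange_def exchange_letter_def)
  next
    case False
    have "exchange_coding p q y = 0 ## exchange_coding p q (y + q)"
      using y by (subst exchange_coding_Stream) (simp add: interval_exchange_def exchange_letter_def)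
    also have "exchange_coding p q (y + q) = 1 ## exchange_coding p q (y + q - p)"
      using False by (subst exchange_coding_Stream) (simp add: interval_exchange_def exchange_letter_def)
    finally show ?thesis using False
      by (simp add: interval_exchange_def exchange_letter_def algebra_simps)
  qed
  ultimately show "(0 \<le> interval_exchange (p - q) q y \<and> interval_exchange (p - q) q y < p) \<and>
    exchange_coding p q y = letter_image D (exchange_letter (p - q) y) @-
      exchange_coding p q (interval_exchange (p - q) q y)" by blast
qed (use assms in simp)

text \<open>Here \<open>p\<close> is the length of the interval of the letter whose frequency decreases when \<open>f\<close>
  is removed: 1 for \<open>G\<close> and 0 for \<open>D\<close>.\<close>

definition standard_coding :: "sturmian_morphism \<Rightarrow> real \<Rightarrow> real \<Rightarrow> bit stream" where
  "standard_coding f p q = (if f = G then exchange_coding q p p else exchange_coding p q q)"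

text \<open>Both codings start at the length of the interval of the letter 1, which is the image of
  0 under the exchange; this choice is compatible with both induced maps.\<close>

lemma standard_coding_step:
  assumes "0 < q" "0 < p"
  shows "standard_coding f (p + q) q = apply_morphism f (standard_coding f p q)"
proof (cases f)
  case G
  show ?thesis
    using exchange_coding_G[of q "p + q" p] assms by (simp add: standard_coding_def G)
next
  case D
  show ?thesis
    using exchange_coding_D[of q "p + q" q] assms by (simp add: standard_coding_def D)
qed

lemma standard_coding_power:
  assumes "0 < q" "0 < p"
  shows "standard_coding f (p + real k * q) q = foldr apply_morphism (replicate k f) (standard_coding f p q)"
proof (induction k)
  case (Suc k)
  have "standard_coding f (p + real (Suc k) * q) q = apply_morphism f (standard_coding f (p + real k * q) q)"
    using standard_coding_step[of q "p + real k * q"] assms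
    by (simp add: algebra_simps add_pos_nonneg)
  then show ?case using Suc by simp
qed simp

lemma standard_coding_swap: "f \<noteq> g \<Longrightarrow> standard_coding f p q = standard_coding g q p"
  by (cases f; cases g) (auto simp: standard_coding_def)

text \<open>Removing a whole block is one division step of Euclid's algorithm on the two interval
  lengths. The letters then change roles, which matches the change of morphism.\<close>

lemma standard_coding_alternating_powers:
  fixes e :: "nat \<Rightarrow> real"
  assumes "X \<noteq> Y" and pos: "\<forall>i\<ge>1. a i > 0" "\<And>N. 0 < e N"
    and rec: "\<And>N. e N = real (a (Suc N)) * e (Suc N) + e (Suc (Suc N))"
  shows "\<exists>s. standard_coding X (e 0) (e 1) = foldr apply_morphism (stake n (alternating_powers X Y a)) s"
proof -
  define f where "f i = (if odd i then X else Y)" for i :: nat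
  define b where "b i = replicate (a i) (f i)" for i
  have "\<exists>w. m \<le> length w \<and> alternating_powers X Y a = w @- flat (smap b (fromN (Suc m))) \<and>
    standard_coding X (e 0) (e 1) = foldr apply_morphism w (standard_coding (f (Suc m)) (e m) (e (Suc m)))" for m
  proof (induction m)
    case 0
    show ?case by (intro exI[of _ "[]"]) (simp add: alternating_powers_def b_def f_def)
  next
    case (Suc m)
    then obtain w where w: "m \<le> length w" "alternating_powers X Y a = w @- flat (smap b (fromN (Suc m)))"
      "standard_coding X (e 0) (e 1) = foldr apply_morphism w (standard_coding (f (Suc m)) (e m) (e (Suc m)))"
      by blast
    have ne: "b (Suc m) \<noteq> []" using pos(1) by (simp add: b_def)
    have "flat (smap b (fromN (Suc m))) = b (Suc m) @- flat (smap b (fromN (Suc (Suc m))))"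
      using ne by (subst siterate.code) simp
    moreover have "standard_coding (f (Suc m)) (e m) (e (Suc m)) =
        foldr apply_morphism (b (Suc m)) (standard_coding (f (Suc m)) (e (Suc (Suc m))) (e (Suc m)))"
      using standard_coding_power[OF pos(2) pos(2), of "f (Suc m)"] rec[of m]
      by (simp add: b_def add.commute)
    moreover have "standard_coding (f (Suc m)) (e (Suc (Suc m))) (e (Suc m)) =
        standard_coding (f (Suc (Suc m))) (e (Suc m)) (e (Suc (Suc m)))"
      using \<open>X \<noteq> Y\<close> by (intro standard_coding_swap) (auto simp: f_def)
    moreover have "Suc m \<le> length (w @ b (Suc m))" using w(1) ne by (cases "b (Suc m)") auto
    ultimately show ?case using w(2,3) by (intro exI[of _ "w @ b (Suc m)"]) simp
  qed
  then obtain w s t where w: "n \<le> length w" "alternating_powers X Y a = w @- t"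
    "standard_coding X (e 0) (e 1) = foldr apply_morphism w s"
    by blast
  \<comment> \<open>\<open>w\<close> ends at a block boundary, possibly beyond \<open>n\<close>; its
    surplus morphisms go into the inner stream.\<close>
  have "stake n (alternating_powers X Y a) = take n w" using w by (simp add: stake_shift)
  moreover have "foldr apply_morphism w s
      = foldr apply_morphism (take n w) (foldr apply_morphism (drop n w) s)"
    using foldr_append[of apply_morphism "take n w" "drop n w" s] by simp
  ultimately show ?thesis using w(3) by auto
qed

text \<open>With total length 1 the exchange sends \<open>x\<close> to
  \<open>frac (x + \<alpha>)\<close>, and the letter is 1 exactly when the floor increases. Modulo 2
  this increment is the sum of adjacent parities.\<close>

lemma exchange_coding_eq_sum_stream:
  assumes \<alpha>: "0 < \<alpha>" "\<alpha> < 1"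
  shows "exchange_coding (1 - \<alpha>) \<alpha> \<alpha> = sum_stream (parity_coding \<alpha> \<alpha>)"
proof (rule snth_equalityI)
  fix i
  have iter: "(interval_exchange (1 - \<alpha>) \<alpha> ^^ i) \<alpha> = frac (\<alpha> + real i * \<alpha>)" for i
  proof (induction i)
    case 0
    show ?case using \<alpha> by (simp add: frac_eq)
  next
    case (Suc i)
    have fa: "frac \<alpha> = \<alpha>" using \<alpha> by (simp add: frac_eq)
    have "frac (\<alpha> + real (Suc i) * \<alpha>) = frac ((\<alpha> + real i * \<alpha>) + \<alpha>)" by (simp add: algebra_simps)
    also have "\<dots> = interval_exchange (1 - \<alpha>) \<alpha> (frac (\<alpha> + real i * \<alpha>))"
      unfolding frac_add fa interval_exchange_def by auto
    finally show ?case using Suc by simp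
  qed
  define w where "w = \<alpha> + real i * \<alpha>"
  have w': "\<alpha> + real (Suc i) * \<alpha> = w + \<alpha>" by (simp add: w_def algebra_simps)
  have "exchange_letter (1 - \<alpha>) (frac w) = of_int (\<lfloor>w + \<alpha>\<rfloor> - \<lfloor>w\<rfloor>)"
  proof (cases "frac w < 1 - \<alpha>")
    case True
    then have "\<lfloor>w + \<alpha>\<rfloor> = \<lfloor>w\<rfloor>" using \<alpha> unfolding frac_def by (intro floor_unique) linarith+
    then show ?thesis using True by (simp add: exchange_letter_def)
  next
    case False
    then have "\<lfloor>w + \<alpha>\<rfloor> = \<lfloor>w\<rfloor> + 1" using \<alpha> unfolding frac_def by (intro floor_unique) (simp; linarith)+
    then show ?thesis using False by (simp add: exchange_letter_def)
  qed
  also have "\<dots> = of_int \<lfloor>w\<rfloor> + of_int \<lfloor>w + \<alpha>\<rfloor>"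
    unfolding of_int_add[symmetric] of_int_bit_eq_iff by simp
  finally show "exchange_coding (1 - \<alpha>) \<alpha> \<alpha> !! i = sum_stream (parity_coding \<alpha> \<alpha>) !! i"
    unfolding snth_sum_stream snth_parity_coding w' w_def[symmetric]
    by (simp add: exchange_coding_def iter w_def)
qed

section \<open>Euclid's algorithm with prescribed quotients\<close>

fun remainders :: "(nat \<Rightarrow> nat) \<Rightarrow> real \<Rightarrow> real \<Rightarrow> nat \<Rightarrow> real" where
  "remainders a x y 0 = x"
| "remainders a x y (Suc N) = remainders (\<lambda>i. a (Suc i)) y (x - real (a 1) * y) N"

lemma remainders_rec:
  "remainders a x y N = real (a (Suc N)) * remainders a x y (Suc N) + remainders a x y (Suc (Suc N))"
proof (induction N arbitrary: a x y)
  case (Suc N)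
  show ?case
    using Suc[of "\<lambda>i. a (Suc i)" y "x - real (a 1) * y"] by (simp only: remainders.simps(2)[of a])
qed simp

lemma remainders_scale: "remainders a (c * x) (c * y) N = c * remainders a x y N"
proof (induction N arbitrary: a x y)
  case (Suc N)
  have "c * x - real (a 1) * (c * y) = c * (x - real (a 1) * y)" by (simp add: algebra_simps)
  show ?case unfolding remainders.simps \<open>c * x - real (a 1) * (c * y) = c * (x - real (a 1) * y)\<close> by (rule Suc)
qed simp

lemma continuous_on_remainders:
  "continuous_on S f \<Longrightarrow> continuous_on S g \<Longrightarrow> continuous_on S (\<lambda>t. remainders a (f t) (g t) N)"
proof (induction N arbitrary: a f g)
  case (Suc N)
  show ?case unfolding remainders.simps
    by (intro Suc.IH Suc.prems continuous_intros)
qed simp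

text \<open>Euclid's algorithm is run backwards: a pair \<open>y\<close>, \<open>z\<close> that is
  good for the shifted quotients is preceded by \<open>a 1 * y + z\<close>.\<close>

lemma remainders_nonneg_exist:
  "\<exists>x y. 0 \<le> x \<and> 0 \<le> y \<and> 0 < x + y \<and> (\<forall>N\<le>m. 0 \<le> remainders a x y N)"
proof (induction m arbitrary: a)
  case 0
  show ?case by (intro exI[of _ 1] exI[of _ 0]) simp
next
  case (Suc m)
  from Suc[of "\<lambda>i. a (Suc i)"] obtain y z where "0 \<le> y \<and> 0 \<le> z \<and> 0 < y + z \<and>
      (\<forall>N\<le>m. 0 \<le> remainders (\<lambda>i. a (Suc i)) y z N)"
    by (elim exE)
  then have yz: "0 \<le> y" "0 \<le> z" "0 < y + z"
    "\<And>N. N \<le> m \<Longrightarrow> 0 \<le> remainders (\<lambda>i. a (Suc i)) y z N"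
    by simp_all
  let ?x = "real (a 1) * y + z"
  have "0 \<le> ?x" using yz(1,2) by simp
  moreover have "0 < ?x + y"
  proof -
    have "0 \<le> real (a 1) * y" using yz(1) by simp
    then show ?thesis using yz(1-3) by linarith
  qed
  moreover have "0 \<le> remainders a ?x y N" if "N \<le> Suc m" for N
  proof (cases N)
    case (Suc N')
    have "?x - real (a 1) * y = z" by simp
    then have "remainders a ?x y N = remainders (\<lambda>i. a (Suc i)) y z N'"
      unfolding Suc remainders.simps by (simp only:)
    then show ?thesis using yz(4)[of N'] that Suc by simp
  qed (use \<open>0 \<le> ?x\<close> in simp)
  ultimately show ?case using yz(1) by (intro exI[of _ ?x] exI[of _ y]) simp
qed

text \<open>The irrational with prescribed partial quotients, by compactness: the \<open>e N\<close> are the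
  remainders of Euclid's algorithm applied to \<open>e 0\<close> and \<open>e 1\<close>.\<close>

lemma positive_remainders_exist:
  assumes a: "\<forall>i\<ge>1. a i > 0"
  obtains e :: "nat \<Rightarrow> real" where "\<And>N. 0 < e N" "e 0 + e 1 = 1"
    "\<And>N. e N = real (a (Suc N)) * e (Suc N) + e (Suc (Suc N))"
proof -
  \<comment> \<open>These sets are closed, nonempty and decreasing in \<open>[0, 1]\<close>; a
    common point \<open>t\<close> keeps all remainders nonnegative.\<close>
  define K where "K m = {t \<in> {0..1}. \<forall>N\<le>m. 0 \<le> remainders a (1 - t) t N}" for m
  have "K m \<noteq> {}" for m
  proof -
    obtain x y where xy: "0 \<le> x" "0 \<le> y" "0 < x + y" "\<And>N. N \<le> m \<Longrightarrow> 0 \<le> remainders a x y N"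
      using remainders_nonneg_exist by blast
    \<comment> \<open>The remainders are homogeneous, so the pair may be scaled to have sum
      1.\<close>
    define c where "c = 1 / (x + y)"
    have c: "0 < c" "c * x = 1 - c * y" using xy by (auto simp: c_def field_simps)
    have "0 \<le> c * x" "0 \<le> c * y" using c(1) xy(1,2) by (auto intro: mult_nonneg_nonneg)
    then have "c * y \<le> 1" using c by linarith
    moreover have "0 \<le> remainders a (1 - c * y) (c * y) N" if "N \<le> m" for N
      using remainders_scale[of a c x y N] xy(4)[OF that] c(1) unfolding c(2) by simp
    ultimately have "c * y \<in> K m" using \<open>0 \<le> c * y\<close> by (simp add: K_def)
    then show ?thesis by blast
  qed
  note K_nonempty = this
  have K_closed: "closed (K m)" for m
  proof -
    have "continuous_on UNIV (\<lambda>t::real. 1 - t)" by (intro continuous_intros)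
    from continuous_on_remainders[OF this continuous_on_id]
    have "closed {t. 0 \<le> remainders a (1 - t) t N}" for N
      by (intro closed_Collect_le continuous_on_const)
    then have "closed ({0..1} \<inter> (\<Inter>N\<in>{..m}. {t. 0 \<le> remainders a (1 - t) t N}))"
      by (intro closed_Int closed_INT closed_atLeastAtMost ballI)
    moreover have "K m = {0..1} \<inter> (\<Inter>N\<in>{..m}. {t. 0 \<le> remainders a (1 - t) t N})" by (auto simp: K_def)
    ultimately show ?thesis by (simp only:)
  qed
  have K_mono: "K m \<subseteq> K n" if "n \<le> m" for m n using that by (auto simp: K_def)
  have "{0..1} \<inter> (\<Inter>m\<in>UNIV. K m) \<noteq> {}"
  proof (rule compact_imp_fip_image)
    show "compact {0..1::real}" by simp
    show "closed (K m)" for m by (rule K_closed)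
    fix I :: "nat set" assume "finite I"
    then have "K (Max (insert 0 I)) \<subseteq> K m" if "m \<in> I" for m
      using that by (intro K_mono) simp
    moreover have "K (Max (insert 0 I)) \<subseteq> {0..1}" by (auto simp: K_def)
    ultimately have "K (Max (insert 0 I)) \<subseteq> {0..1} \<inter> (\<Inter>m\<in>I. K m)" by (intro Int_greatest INT_greatest)
    then show "{0..1} \<inter> (\<Inter>m\<in>I. K m) \<noteq> {}" using K_nonempty[of "Max (insert 0 I)"] by (metis subset_empty)
  qed
  then obtain t where t: "\<And>m. t \<in> K m" by auto
  define e where "e = remainders a (1 - t) t"
  have nonneg: "0 \<le> e N" for N using t[of N] by (simp add: K_def e_def)
  have rec: "e N = real (a (Suc N)) * e (Suc N) + e (Suc (Suc N))" for N
    unfolding e_def by (rule remainders_rec)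
  have sum: "e 0 + e 1 = 1" by (simp add: e_def)
  \<comment> \<open>Two consecutive zeros would propagate back to the start and contradict
    \<open>e 0 + e 1 = 1\<close>.\<close>
  have "0 < e N + e (Suc N)" for N
  proof (induction N)
    case (Suc N)
    show ?case
    proof (rule ccontr)
      assume "\<not> ?thesis"
      then have "e (Suc N) = 0" "e (Suc (Suc N)) = 0"
        using nonneg[of "Suc N"] nonneg[of "Suc (Suc N)"] by linarith+
      then show False using Suc rec[of N] by simp
    qed
  qed (use sum in simp)
  note pos2 = this
  \<comment> \<open>A single zero is followed by a positive remainder, and the recurrence would make
    the one after that negative.\<close>
  have "0 < e N" for N
  proof (rule ccontr)
    assume "\<not> 0 < e N"
    then have "e N = 0" using nonneg[of N] by simp
    then have "0 < e (Suc N)" using pos2[of N] by simp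
    moreover have "a (Suc N) > 0" using a by simp
    ultimately have "0 < real (a (Suc N)) * e (Suc N)" by simp
    then show False using rec[of N] \<open>e N = 0\<close> nonneg[of "Suc (Suc N)"] by linarith
  qed
  then show ?thesis using sum rec by (rule that)
qed

section \<open>The values of the recurrence function\<close>

lemma convergent_rec_rec:
  "convergent_rec a x y (N + 2) = a (N + 2) * convergent_rec a x y (N + 1) + convergent_rec a x y N"
  by (simp add: numeral_2_eq_2)

text \<open>The signed distances obey the recurrence of the remainders up to alternating signs. The
  two options in \<open>init\<close> are the two directive types: with
  \<open>\<theta> = e 1 / e 0\<close>, the rotation number is \<open>1 / (1 + \<theta>)\<close> with
  numerators \<open>conv_q\<close>, or \<open>\<theta> / (1 + \<theta>)\<close> with numerators
  \<open>conv_p\<close>.\<close>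

lemma convergent_pair_convergent_rec:
  fixes e :: "nat \<Rightarrow> real"
  assumes init: "x = 0 \<and> y = 1 \<and> \<alpha> = e 0 \<and> \<sigma> = -1 \<or> x = 1 \<and> y = 0 \<and> \<alpha> = e 1 \<and> \<sigma> = 1"
    and a: "\<forall>i\<ge>1. a i > 0"
    and e: "\<And>N. 0 < e N" "e 0 + e 1 = 1" "\<And>N. e N = real (a (Suc N)) * e (Suc N) + e (Suc (Suc N))"
  shows "convergent_pair \<alpha> (conv_q' a N) (conv_q' a (N + 1))
    (convergent_rec a x y N) (convergent_rec a x y (N + 1)) (e (N + 1)) (e (N + 2)) (\<sigma> * (-1) ^ N)"
proof -
  let ?Q = "conv_q' a" and ?P = "convergent_rec a x y"
  have Q_rec: "?Q (N + 2) = a (N + 2) * ?Q (N + 1) + ?Q N" for N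
    unfolding conv_q'_def by (rule convergent_rec_rec)
  have \<sigma>: "\<sigma> = 1 \<or> \<sigma> = -1" using init by auto
  have Z: "real (?Q N) * \<alpha> - real (?P N) = \<sigma> * (-1) ^ N * e (N + 1) \<and>
      real (?Q (N + 1)) * \<alpha> - real (?P (N + 1)) = - (\<sigma> * (-1) ^ N * e (N + 2))" for N
  proof (induction N)
    case 0
    have e2: "e (Suc (Suc 0)) = e 0 - real (a (Suc 0)) * e (Suc 0)" using e(3)[of 0] by simp
    from init show ?case
    proof (elim disjE conjE)
      assume "x = 0" "y = 1" "\<alpha> = e 0" "\<sigma> = -1"
      have e1: "e (Suc 0) = 1 - e 0" using e(2) by simp
      show ?thesis
        unfolding \<open>x = 0\<close> \<open>y = 1\<close> \<open>\<alpha> = e 0\<close> \<open>\<sigma> = -1\<close>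
        by (simp add: conv_q'_def e1 e2 algebra_simps)
    next
      assume "x = 1" "y = 0" "\<alpha> = e 1" "\<sigma> = 1"
      moreover have "e 0 = 1 - e (Suc 0)" using e(2) by simp
      ultimately show ?thesis by (simp add: conv_q'_def e2 algebra_simps)
    qed
  next
    case (Suc N)
    have "real (?Q (N + 2)) * \<alpha> - real (?P (N + 2)) =
        real (a (N + 2)) * (real (?Q (N + 1)) * \<alpha> - real (?P (N + 1))) + (real (?Q N) * \<alpha> - real (?P N))"
      unfolding Q_rec convergent_rec_rec[of a x y N] by (simp add: algebra_simps)
    also have "\<dots> = real (a (N + 2)) * - (\<sigma> * (-1) ^ N * e (N + 2)) + \<sigma> * (-1) ^ N * e (N + 1)"
      by (simp only: Suc[THEN conjunct1] Suc[THEN conjunct2])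
    also have "\<dots> = \<sigma> * (-1) ^ N * (e (N + 1) - real (a (N + 2)) * e (N + 2))"
      by (simp add: algebra_simps)
    also have "e (N + 1) - real (a (N + 2)) * e (N + 2) = e (N + 3)"
      using e(3)[of "N + 1"] by (simp add: numeral_eq_Suc)
    finally show ?case using Suc by (simp add: numeral_eq_Suc)
  qed
  have det: "int (?P (N + 1)) * int (?Q N) - int (?P N) * int (?Q (N + 1)) = 1 \<or>
      int (?P (N + 1)) * int (?Q N) - int (?P N) * int (?Q (N + 1)) = -1" for N
  proof (induction N)
    case 0
    show ?case using init by (auto simp: conv_q'_def)
  next
    case (Suc N)
    have "int (?P (N + 2)) * int (?Q (N + 1)) - int (?P (N + 1)) * int (?Q (N + 2)) =
        - (int (?P (N + 1)) * int (?Q N) - int (?P N) * int (?Q (N + 1)))"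
      unfolding Q_rec convergent_rec_rec[of a x y N] by (simp add: algebra_simps)
    then show ?case using Suc by auto
  qed
  have Q_pos: "0 < ?Q N \<and> 0 < ?Q (N + 1)" for N
  proof (induction N)
    case (Suc N)
    then show ?case using Q_rec[of N] by simp
  qed (simp add: conv_q'_def)
  have sq: "(\<sigma> * (-1) ^ N) * (\<sigma> * (-1) ^ N) = 1" using \<sigma> by (auto simp flip: power_mult_distrib)
  have "1 \<le> real (a (N + 2))" using a by (simp add: Suc_le_eq)
  then have "e (N + 2) * 1 \<le> e (N + 2) * real (a (N + 2))" using e(1)[of "N + 2"] by (intro mult_left_mono) auto
  then have "e (N + 2) < e (N + 1)" using e(3)[of "N + 1"] e(1)[of "N + 3"] by (simp add: numeral_eq_Suc algebra_simps)
  show ?thesis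
  proof
    show "\<sigma> * (-1) ^ N = 1 \<or> \<sigma> * (-1) ^ N = -1" using \<sigma> by (cases "even N") auto
    have "(\<sigma> * (-1) ^ N) * (\<sigma> * (-1) ^ N * e (N + 1)) = e (N + 1)"
      using sq by (metis mult.assoc mult_1)
    then show "\<sigma> * (-1) ^ N * (real (?Q N) * \<alpha> - real (?P N)) = e (N + 1)" using Z[of N] by metis
    have "(\<sigma> * (-1) ^ N) * - (\<sigma> * (-1) ^ N * e (N + 2)) = - e (N + 2)"
      using sq by (metis mult.assoc mult_1 mult_minus_right)
    then show "\<sigma> * (-1) ^ N * (real (?Q (N + 1)) * \<alpha> - real (?P (N + 1))) = - e (N + 2)"
      using Z[of N] by metis
  qed (use Q_pos det e(1) \<open>e (N + 2) < e (N + 1)\<close> in auto)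
qed

text \<open>Quotients are at least 1, so each remainder is at least the sum of the next two, and two
  steps at least halve it.\<close>

lemma remainders_arbitrarily_small:
  fixes e :: "nat \<Rightarrow> real"
  assumes a: "\<forall>i\<ge>1. a i > 0" and e: "\<And>N. 0 < e N"
    "\<And>N. e N = real (a (Suc N)) * e (Suc N) + e (Suc (Suc N))" and l: "0 < l"
  shows "\<exists>N. e (Suc N) < l"
proof -
  have step: "e (Suc N) + e (Suc (Suc N)) \<le> e N" for N
  proof -
    have "1 \<le> real (a (Suc N))" using a by (simp add: Suc_le_eq)
    then have "1 * e (Suc N) \<le> real (a (Suc N)) * e (Suc N)" using e(1)[of "Suc N"] by (intro mult_right_mono) auto
    then show ?thesis using e(2)[of N] by linarith
  qed
  have bound: "e (Suc (2 * k)) \<le> (1 / 2) ^ k * e 1" for k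
  proof (induction k)
    case (Suc k)
    have "2 * e (Suc (2 * Suc k)) \<le> e (Suc (2 * k))"
      using step[of "Suc (2 * k)"] step[of "Suc (Suc (2 * k))"] e(1)[of "Suc (Suc (Suc (Suc (2 * k))))"] by simp
    then show ?case using Suc by simp
  qed simp
  obtain k where k: "(1 / 2) ^ k < l / e 1" using real_arch_pow_inv[of "l / e 1" "1 / 2"] l e(1)[of 1] by auto
  then have "(1 / 2) ^ k * e 1 < l" using e(1)[of 1] by (simp add: field_simps)
  then show ?thesis using bound[of k] by (intro exI[of _ "2 * k"]) linarith
qed

lemma recurrence_function_values:
  fixes v u :: "bit stream" and a :: "nat \<Rightarrow> nat"
  assumes v: "complementary_symmetric v" "language (sum_stream v) = language u"
    and a: "\<forall>i\<ge>1. a i > 0" and XY: "X \<noteq> Y"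
    and dir: "directive_sequence u (alternating_powers X Y a)"
    and P: "P = (if X = G then conv_q a else conv_p a)"
    and n: "n \<in> {conv_q' a N ..< conv_q' a (N + 1)}"
  shows "(even (P N) \<longrightarrow>
          (a (N + 2) > 1 \<longrightarrow>
             recurrence_function v (n + 1) = 2 * conv_q' a (N + 1) + conv_q' a N + n) \<and>
          (a (N + 2) = 1 \<longrightarrow>
             recurrence_function v (n + 1) = 2 * conv_q' a (N + 2) + n)) \<and>
       (even (P (N + 1)) \<longrightarrow>
          (a (N + 2) > 1 \<longrightarrow>
             recurrence_function v (n + 1) = conv_q' a (N + 2) + 2 * conv_q' a (N + 1) + conv_q' a N + n) \<and>
          (a (N + 2) = 1 \<longrightarrow>
             recurrence_function v (n + 1) = 2 * conv_q' a (N + 2) + conv_q' a (N + 1) + n)) \<and>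
       (odd (P N) \<and> odd (P (N + 1)) \<longrightarrow>
          (a (N + 2) > 1 \<longrightarrow>
             recurrence_function v (n + 1) = 3 * conv_q' a (N + 1) + conv_q' a N + n) \<and>
          (a (N + 2) = 1 \<longrightarrow>
             recurrence_function v (n + 1) = conv_q' a (N + 3) + conv_q' a (N + 2) + conv_q' a (N + 1) + n))"
proof -
  obtain e :: "nat \<Rightarrow> real" where e: "\<And>N. 0 < e N" "e 0 + e 1 = 1"
    "\<And>N. e N = real (a (Suc N)) * e (Suc N) + e (Suc (Suc N))"
    using positive_remainders_exist[OF a] by blast
  define \<alpha> where "\<alpha> = (if X = G then e 0 else e 1)"
  define \<sigma> :: real where "\<sigma> = (if X = G then -1 else 1)"
  define x y :: nat where "x = (if X = G then 0 else 1)" and "y = (if X = G then 1 else 0)"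
  have P_rec: "P = convergent_rec a x y" by (simp add: P x_def y_def conv_q_def conv_p_def)
  have pair: "convergent_pair \<alpha> (conv_q' a N) (conv_q' a (N + 1)) (P N) (P (N + 1))
      (e (N + 1)) (e (N + 2)) (\<sigma> * (-1) ^ N)" for N
    unfolding P_rec
    by (rule convergent_pair_convergent_rec[OF _ a e]) (simp add: \<alpha>_def \<sigma>_def x_def y_def)
  \<comment> \<open>Both streams can be desubstituted along the same morphisms to every depth, so
    they coincide.\<close>
  have "u = standard_coding X (e 0) (e 1)"
  proof (rule directive_sequence_unique)
    show "\<exists>s. u = foldr apply_morphism (stake n (alternating_powers X Y a)) s" for n
      using dir unfolding directive_sequence_def by blast
    show "\<exists>s. standard_coding X (e 0) (e 1) = foldr apply_morphism (stake n (alternating_powers X Y a)) s" for n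
      by (rule standard_coding_alternating_powers[OF XY a e(1,3)])
  qed
  also have "\<dots> = exchange_coding (1 - \<alpha>) \<alpha> \<alpha>"
  proof -
    have "e 1 = 1 - e 0" "e 0 = 1 - e 1" using e(2) by simp_all
    then show ?thesis by (cases X) (simp_all add: standard_coding_def \<alpha>_def)
  qed
  also have "\<dots> = sum_stream (parity_coding \<alpha> \<alpha>)"
    by (rule exchange_coding_eq_sum_stream) (use e(1)[of 0] e(1)[of 1] e(2) in \<open>auto simp: \<alpha>_def\<close>)
  finally have lang: "language (sum_stream v) = language (sum_stream (parity_coding \<alpha> \<alpha>))"
    using v(2) by simp
  have fac: "factors v m = range (\<lambda>z. stake m (parity_coding \<alpha> z))" for m
  proof (rule factors_eq_parity_codings[OF v(1) lang])
    fix l :: real assume "0 < l"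
    then obtain N where "e (Suc N) < l / 2"
      using remainders_arbitrarily_small[OF a e(1,3), of "l / 2"] by auto
    then have "2 * e (Suc N) \<le> l" by simp
    moreover have "orbit_covers \<alpha> (2 * e (Suc N)) (2 * conv_q' a N + 2 * conv_q' a (N + 1))"
      using convergent_pair.covers_twice[OF pair[of N]] by simp
    ultimately show "\<exists>T. orbit_covers \<alpha> l T" using orbit_covers_mono by blast
  qed
  interpret convergent_pair \<alpha> "conv_q' a N" "conv_q' a (N + 1)" "P N" "P (N + 1)" "e (N + 1)" "e (N + 2)"
    "\<sigma> * (-1) ^ N" by (rule pair)
  have "e (N + 1) \<le> 1"
  proof (cases N)
    case 0
    then show ?thesis using e(1)[of 0] e(2) by simp
  next
    case (Suc M)
    have "e (Suc k) \<le> 1" for k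
    proof (induction k)
      case 0
      then show ?case using e(1)[of 0] e(2) by simp
    next
      case (Suc k)
      then show ?case using convergent_pair.\<eta>(2)[OF pair[of k]] by simp
    qed
    then show ?thesis by simp
  qed
  \<comment> \<open>Nonzero times of modulus at most \<open>n\<close>, hence below the next
    denominator, stay at least \<open>e (N + 1)\<close> away from the integers, and the time
    \<open>conv_q' a N\<close> attains this distance. Only the covering time of arcs of this length
    remains to be found.\<close>
  have val: "recurrence_function v (n + 1) = T + n"
    if "orbit_covers \<alpha> (e (N + 1)) T" "\<not> orbit_covers \<alpha> (e (N + 1)) (T - 1)" for T
  proof (rule recurrence_function_eqI[OF fac])
    show "e (N + 1) \<le> \<bar>of_int j * \<alpha> - of_int m\<bar>" if "j \<noteq> 0" "\<bar>j\<bar> \<le> int n" for j m :: int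
      using that n by (intro best_approximation) auto
    show "conv_q' a N \<le> n" using n by simp
  qed (use \<open>e (N + 1) \<le> 1\<close> e(1) sign dist that in auto)
  have Q2: "conv_q' a (N + 2) = a (N + 2) * conv_q' a (N + 1) + conv_q' a N"
    unfolding conv_q'_def by (rule convergent_rec_rec)
  have Q3: "conv_q' a (N + 3) = a (N + 3) * conv_q' a (N + 2) + conv_q' a (N + 1)"
    using convergent_rec_rec[of a 1 1 "N + 1"] unfolding conv_q'_def by (simp add: numeral_eq_Suc)
  have e3: "e (N + 3) = e (N + 1) - real (a (N + 2)) * e (N + 2)"
    using e(3)[of "N + 1"] by (simp add: numeral_eq_Suc)
  have e4: "e (N + 4) = e (N + 2) - real (a (N + 3)) * e (N + 3)"
    using e(3)[of "N + 2"] by (simp add: numeral_eq_Suc)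
  have dec: "e (N + 3) < e (N + 2)" "e (N + 4) < e (N + 3)"
    using convergent_pair.\<eta>(2)[OF pair[of "N + 1"]] convergent_pair.\<eta>(2)[OF pair[of "N + 2"]]
    by (simp_all add: numeral_eq_Suc)
  have pos: "0 < e (N + 3)" "0 < e (N + 4)" using e(1) by auto
  have a1: "1 \<le> a (N + 2)" "1 \<le> a (N + 3)" using a by (auto simp: Suc_le_eq)
  consider "even (P N)" "odd (P (N + 1))" | "odd (P N)" "even (P (N + 1))" | "odd (P N)" "odd (P (N + 1))"
    using not_both_even by blast
  then show ?thesis
  proof cases
    case 1
    have "recurrence_function v (n + 1) = 2 * conv_q' a (N + 1) + conv_q' a N + n" if "a (N + 2) > 1"
      using val covers_even[OF 1 that] pos e3 by simp
    moreover have "recurrence_function v (n + 1) = 2 * conv_q' a (N + 2) + n" if "a (N + 2) = 1"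
      using val covers_even_1[OF 1] dec e3 that Q2 by simp
    ultimately show ?thesis using 1 by blast
  next
    case 2
    \<comment> \<open>Both claimed values are rewritings of this one formula by
      \<open>Q2\<close>.\<close>
    have "recurrence_function v (n + 1) = 2 * conv_q' a N + (a (N + 2) + 2) * conv_q' a (N + 1) + n"
      using val covers_odd_even[OF 2 a1(1)] pos dec e3 by simp
    then show ?thesis using 2 Q2 by (auto simp: algebra_simps)
  next
    case 3
    have "recurrence_function v (n + 1) = 3 * conv_q' a (N + 1) + conv_q' a N + n" if "a (N + 2) > 1"
      using val covers_odd_odd[OF 3 that] pos e3 by simp
    moreover have "recurrence_function v (n + 1) =
        conv_q' a (N + 3) + conv_q' a (N + 2) + conv_q' a (N + 1) + n" if "a (N + 2) = 1"
    proof -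
      \<comment> \<open>With quotient 1 the next remainder is \<open>\<eta> - \<eta>1\<close>, so
        \<open>a (N + 3)\<close> is the \<open>b\<close> of \<open>covers_odd_odd_1\<close>.\<close>
      have "e (N + 3) = e (N + 1) - e (N + 2)" using e3 that by simp
      then have "recurrence_function v (n + 1) =
          (a (N + 3) + 1) * (conv_q' a (N + 1) + conv_q' a N) + 2 * conv_q' a (N + 1) + n"
        using val covers_odd_odd_1[OF 3 _ a1(2)] pos dec e4 by simp
      then show ?thesis using Q2 Q3 that by (simp add: algebra_simps)
    qed
    ultimately show ?thesis using 3 by blast
  qed
qed

theorem theorem53:
  fixes v u :: "bit stream" and a :: "nat \<Rightarrow> nat"
  assumes "CS_rote v"
    and "standard_sturmian u"
    and "language (sum_stream v) = language u"
    and "\<forall>i\<ge>1. a i > 0"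
  shows "(directive_sequence u (alternating_powers G D a) \<longrightarrow>
      (\<forall>N. \<forall>n \<in> {conv_q' a N ..< conv_q' a (N + 1)}.
           (even (conv_q a N) \<longrightarrow>
              (a (N + 2) > 1 \<longrightarrow>
                 recurrence_function v (n + 1) = 2 * conv_q' a (N + 1) + conv_q' a N + n) \<and>
              (a (N + 2) = 1 \<longrightarrow>
                 recurrence_function v (n + 1) = 2 * conv_q' a (N + 2) + n)) \<and>
           (even (conv_q a (N + 1)) \<longrightarrow>
              (a (N + 2) > 1 \<longrightarrow>
                 recurrence_function v (n + 1) = conv_q' a (N + 2) + 2 * conv_q' a (N + 1) + conv_q' a N + n) \<and>
              (a (N + 2) = 1 \<longrightarrow>
                 recurrence_function v (n + 1) = 2 * conv_q' a (N + 2) + conv_q' a (N + 1) + n)) \<and>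
           (odd (conv_q a N) \<and> odd (conv_q a (N + 1)) \<longrightarrow>
              (a (N + 2) > 1 \<longrightarrow>
                 recurrence_function v (n + 1) = 3 * conv_q' a (N + 1) + conv_q' a N + n) \<and>
              (a (N + 2) = 1 \<longrightarrow>
                 recurrence_function v (n + 1) = conv_q' a (N + 3) + conv_q' a (N + 2) + conv_q' a (N + 1) + n)))) \<and>
    (directive_sequence u (alternating_powers D G a) \<longrightarrow>
      (\<forall>N. \<forall>n \<in> {conv_q' a N ..< conv_q' a (N + 1)}.
           (even (conv_p a N) \<longrightarrow>
              (a (N + 2) > 1 \<longrightarrow>
                 recurrence_function v (n + 1) = 2 * conv_q' a (N + 1) + conv_q' a N + n) \<and>
              (a (N + 2) = 1 \<longrightarrow>
                 recurrence_function v (n + 1) = 2 * conv_q' a (N + 2) + n)) \<and>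
           (even (conv_p a (N + 1)) \<longrightarrow>
              (a (N + 2) > 1 \<longrightarrow>
                 recurrence_function v (n + 1) = conv_q' a (N + 2) + 2 * conv_q' a (N + 1) + conv_q' a N + n) \<and>
              (a (N + 2) = 1 \<longrightarrow>
                 recurrence_function v (n + 1) = 2 * conv_q' a (N + 2) + conv_q' a (N + 1) + n)) \<and>
           (odd (conv_p a N) \<and> odd (conv_p a (N + 1)) \<longrightarrow>
              (a (N + 2) > 1 \<longrightarrow>
                 recurrence_function v (n + 1) = 3 * conv_q' a (N + 1) + conv_q' a N + n) \<and>
              (a (N + 2) = 1 \<longrightarrow>
                 recurrence_function v (n + 1) = conv_q' a (N + 3) + conv_q' a (N + 2) + conv_q' a (N + 1) + n))))"
proof -
  have sym: "complementary_symmetric v" using assms(1) by (simp add: CS_rote_def)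
  have "G \<noteq> D" "D \<noteq> G" by simp_all
  note G = recurrence_function_values[OF sym assms(3,4) \<open>G \<noteq> D\<close> _ refl, unfolded if_P[OF refl]]
  note D = recurrence_function_values[OF sym assms(3,4) \<open>D \<noteq> G\<close> _ refl, unfolded if_not_P[OF \<open>D \<noteq> G\<close>]]
  show ?thesis by (rule conjI; intro impI allI ballI; rule G D; assumption)
qed

end
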